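(* Let $\nu>1$, let $h:[0,1]\to[1,+\infty)$ be a $C^1$-function, and let $S\in(0,1)$ be a solution of $$S=1-\frac{1}{\nu h(S)}$$ such that $$|h'(S)|<\frac{1}{\nu S}\left(\frac{1}{\sqrt{1-S}}-1\right)^2.$$ Then the probability distribution $\pi_S$ on $\mathbb{N}$ given by $$\pi_S(n)=\left(\frac{1}{\nu h(S)}\right)^n\left(1-\frac{1}{\nu h(S)}\right),\quad n\in\mathbb{N},$$ is an exponentially stable equilibrium point of the dynamical system (NLQ): there exist positive constants $q$ and $\varepsilon$ such that, if $\|\Gamma(0)-\pi_S\|_2\le\varepsilon$, then $$\|\Gamma(t)-\pi_S\|_2^2\le\|\Gamma(0)-\pi_S\|_2^2\; e^{-qt}\qquad\text{for all }t\ge0.$$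
   Context: $\mathbb{N}=\{0,1,2,\dots\}$ and $\mathcal{P}(\mathbb{N})$ is the set of probability distributions on $\mathbb{N}$. The dynamical system (NLQ) (non-linear $M/M/1$ queue) is the $\mathcal{P}(\mathbb{N})$-valued function $(\Gamma(t))=(\Gamma(t)(k),k\in\mathbb{N})$ satisfying, for every function $f:\mathbb{N}\to\mathbb{R}_+$ with finite support, $$\frac{\mathrm{d}}{\mathrm{d}t}\langle\Gamma(t),f\rangle=\langle\Gamma(t),\nabla^+(f)\rangle+\nu h(\Gamma(t)(0))\,\langle\Gamma(t),\nabla^-(f)\rangle,$$ where $\langle\zeta,f\rangle=\sum_kf(k)\zeta(k)$, $\nabla^+(f)(x)=f(x+1)-f(x)$ and $\nabla^-(f)(x)=(f(x-1)-f(x))\mathbf{1}_{\{x>0\}}$. For $\mu\in\mathcal{P}(\mathbb{N})$, $\|\mu-\pi_S\|_2^2=\sum_{n\in\mathbb{N}}\frac{(\mu(n)-\pi_S(n))^2}{\pi_S(n)}$. *)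

theory Defs
  imports "HOL-Probability.Probability"
begin

definition pairing :: "nat pmf \<Rightarrow> (nat \<Rightarrow> real) \<Rightarrow> real" where
  "pairing \<zeta> f = (\<Sum>\<^sub>\<infinity>k. f k * pmf \<zeta> k)"

definition grad_plus :: "(nat \<Rightarrow> real) \<Rightarrow> nat \<Rightarrow> real" where
  "grad_plus f x = f (x + 1) - f x"

definition grad_minus :: "(nat \<Rightarrow> real) \<Rightarrow> nat \<Rightarrow> real" where
  "grad_minus f x = (if x > 0 then f (x - 1) - f x else 0)"

text \<open>Only the values of \<open>\<Gamma>\<close> on \<open>[0, \<infinity>)\<close> matter; the derivative at \<open>t = 0\<close> is the right derivative.\<close>

definition NLQ :: "real \<Rightarrow> (real \<Rightarrow> real) \<Rightarrow> (real \<Rightarrow> nat pmf) \<Rightarrow> bool" where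
  "NLQ \<nu> h \<Gamma> \<longleftrightarrow>
    (\<forall>f. (\<forall>x. 0 \<le> f x) \<and> finite {x. f x \<noteq> 0} \<longrightarrow>
      (\<forall>t\<ge>0. ((\<lambda>s. pairing (\<Gamma> s) f) has_real_derivative
         pairing (\<Gamma> t) (grad_plus f) + \<nu> * h (pmf (\<Gamma> t) 0) * pairing (\<Gamma> t) (grad_minus f))
        (at t within {0..})))"

text \<open>The norm \<open>\<parallel>\<mu> - \<pi>\<parallel>\<^sub>2\<close> takes values in \<open>[0, \<infinity>]\<close>: the series may diverge, in which case
  the norm is \<open>\<infinity>\<close>.\<close>

definition l2_dist :: "nat pmf \<Rightarrow> nat pmf \<Rightarrow> ennreal" where
  "l2_dist \<mu> \<pi> =
    (let s = (\<Sum>n. ennreal ((pmf \<mu> n - pmf \<pi> n)\<^sup>2 / pmf \<pi> n))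
     in if s = \<infinity> then \<infinity> else ennreal (sqrt (enn2real s)))"

lemma l2_dist_power2:
  "(l2_dist \<mu> \<pi>)\<^sup>2 = (\<Sum>n. ennreal ((pmf \<mu> n - pmf \<pi> n)\<^sup>2 / pmf \<pi> n))"
proof -
  define s where "s = (\<Sum>n. ennreal ((pmf \<mu> n - pmf \<pi> n)\<^sup>2 / pmf \<pi> n))"
  have "(if s = \<infinity> then \<infinity> else ennreal (sqrt (enn2real s)))\<^sup>2 = s"
    by (cases s) (auto simp: ennreal_power ennreal_top_eq_mult_iff power2_eq_square ennreal_mult[symmetric])
  then show ?thesis
    unfolding l2_dist_def s_def Let_def .
qed

definition pi_S :: "real \<Rightarrow> (real \<Rightarrow> real) \<Rightarrow> real \<Rightarrow> nat pmf" where
  "pi_S \<nu> h S = embed_pmf (\<lambda>n. (1 / (\<nu> * h S)) ^ n * (1 - 1 / (\<nu> * h S)))"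

text \<open>\<open>embed_pmf\<close> is meaningful only for weights that are nonnegative and sum to \<open>1\<close>.\<close>

lemma pi_S_geometric:
  assumes "\<nu> * h S > 1"
  shows "pi_S \<nu> h S = geometric_pmf (1 - 1 / (\<nu> * h S))"
proof -
  have "(\<lambda>n. (1 / (\<nu> * h S)) ^ n * (1 - 1 / (\<nu> * h S)))
      = pmf (geometric_pmf (1 - 1 / (\<nu> * h S)))"
    using assms by (auto simp: fun_eq_iff)
  moreover have "embed_pmf (pmf p) = p" for p :: "nat pmf"
    by (intro pmf_eqI pmf_embed_pmf) (auto simp: nn_integral_pmf measure_pmf.emeasure_space_1[simplified])
  ultimately show ?thesis
    by (simp add: pi_S_def)
qed

lemma pmf_pi_S:
  assumes "\<nu> * h S > 1"
  shows "pmf (pi_S \<nu> h S) n = (1 / (\<nu> * h S)) ^ n * (1 - 1 / (\<nu> * h S))"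
  using assms by (simp add: pi_S_geometric)

end

theory Submission imports Defs begin

text \<open>
  Testing the equation against indicators turns it into the forward equation \<open>p\<^sub>k' = J\<^sub>k\<^sub>-\<^sub>1 - J\<^sub>k\<close>
  of an \<open>M/M/1\<close> queue with arrival rate \<open>1\<close> and service rate \<open>\<mu> = \<nu> h(p\<^sub>0)\<close>, where
  \<open>J\<^sub>k = p\<^sub>k - \<mu> p\<^sub>k\<^sub>+\<^sub>1\<close>. With \<open>g = p / \<pi> - 1\<close> the derivative of the energy
  \<open>E = \<Sum>\<^sub>k \<pi>\<^sub>k g\<^sub>k\<^sup>2\<close> is \<open>- 2 D\<close>, where \<open>D = \<Sum>\<^sub>k \<pi>\<^sub>k (g\<^sub>k\<^sub>+\<^sub>1 - g\<^sub>k)\<^sup>2\<close>, plus a perturbation due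
  to \<open>\<mu> - 1 / \<rho>\<close> (with \<open>\<rho> = 1 - S\<close>), whose leading term is at most \<open>2 \<nu> \<bar>h'(S)\<bar> (p\<^sub>0 - S)\<^sup>2 \<le> 2 \<nu> \<bar>h'(S)\<bar> S E\<close>.
  A Poincare inequality gives \<open>D \<ge> (1 / sqrt \<rho> - 1)\<^sup>2 E\<close>, so by hypothesis the dissipation wins
  as long as \<open>\<bar>p\<^sub>0 - S\<bar>\<close> is small, and the decay of \<open>E\<close> keeps it small. The infinite sum is
  differentiated in integrated form, by dominated convergence; the required local bound on \<open>E\<close> comes
  from a crude exponential estimate for \<open>\<Sum>\<^sub>k \<rho>\<^sup>-\<^sup>k p\<^sub>k\<^sup>2\<close>.
\<close>

section \<open>Differential inequalities and limits of truncated sums\<close>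

text \<open>With the integrating factor, \<open>f s * exp (- C * s) - e * s\<close> is
  nonincreasing. Estimating \<open>e * exp (- C * s)\<close> by \<open>e\<close> avoids a division
  by \<open>C\<close>, so that \<open>C = 0\<close> is covered.\<close>

lemma gronwall_affine:
  fixes f f' :: "real \<Rightarrow> real"
  assumes der: "\<And>s. s \<ge> 0 \<Longrightarrow> (f has_real_derivative f' s) (at s within {0..})"
    and bound: "\<And>s. s \<ge> 0 \<Longrightarrow> f' s \<le> C * f s + e"
    and "C \<ge> 0" "e \<ge> 0" "t \<ge> 0"
  shows "f t \<le> exp (C * t) * (f 0 + e * t)"
proof -
  define \<phi> where "\<phi> s = f s * exp (- C * s) - e * s" for s
  define \<phi>' where "\<phi>' s = (f' s - C * f s) * exp (- C * s) - e" for s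
  have d: "(\<phi> has_real_derivative \<phi>' s) (at s within {0..})" if "s \<ge> 0" for s
    unfolding \<phi>_def \<phi>'_def
    by (rule derivative_eq_intros der that refl | simp add: algebra_simps)+
  have "\<phi> t \<le> \<phi> 0"
  proof (rule DERIV_nonpos_imp_decreasing_open[OF \<open>t \<ge> 0\<close>])
    fix x assume x: "0 < x" "x < t"
    have "at x within {0..} = at x"
      by (rule at_within_interior) (use x in auto)
    then have "DERIV \<phi> x :> \<phi>' x" using d[of x] x by simp
    moreover have "\<phi>' x \<le> 0"
    proof -
      have "(f' x - C * f x) * exp (- C * x) \<le> e * exp (- C * x)"
        using bound[of x] x by (intro mult_right_mono) auto
      also have "\<dots> \<le> e * 1"
        using assms x by (intro mult_left_mono) auto
      finally show ?thesis by (simp add: \<phi>'_def)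
    qed
    ultimately show "\<exists>y. DERIV \<phi> x :> y \<and> y \<le> 0" by blast
  next
    show "continuous_on {0..t} \<phi>"
      by (rule continuous_on_subset[of "{0..}"])
        (auto intro!: continuous_on_eq_continuous_within[THEN iffD2] DERIV_continuous d)
  qed
  then have "f t * exp (- C * t) \<le> f 0 + e * t" by (simp add: \<phi>_def)
  then have "exp (C * t) * (f t * exp (- C * t)) \<le> exp (C * t) * (f 0 + e * t)"
    by (intro mult_left_mono) auto
  moreover have "exp (C * t) * (f t * exp (- C * t)) = f t"
    using exp_minus_inverse[of "C * t"] by (simp add: mult.left_commute)
  ultimately show ?thesis by (simp only:)
qed

text \<open>The fundamental theorem recovers the increment of each \<open>F n\<close>, and dominated
  convergence identifies \<open>lb - la\<close> with the integral of \<open>G\<close>. Only the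
  truncations \<open>F n\<close> are differentiated, which suits an energy given by an infinite
  series.\<close>

lemma limit_le_of_nonpos_limit_derivative:
  fixes F F' :: "nat \<Rightarrow> real \<Rightarrow> real"
  assumes "a \<le> b"
    and der: "\<And>n s. s \<in> {a..b} \<Longrightarrow> (F n has_real_derivative F' n s) (at s within {a..b})"
    and bounded: "\<And>n s. s \<in> {a..b} \<Longrightarrow> \<bar>F' n s\<bar> \<le> B"
    and lim: "\<And>s. s \<in> {a..b} \<Longrightarrow> (\<lambda>n. F' n s) \<longlonglongrightarrow> G s"
    and nonpos: "\<And>s. s \<in> {a..b} \<Longrightarrow> G s \<le> 0"
    and "(\<lambda>n. F n a) \<longlonglongrightarrow> la" "(\<lambda>n. F n b) \<longlonglongrightarrow> lb"
  shows "lb \<le> la"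
proof -
  have int: "(F' n has_integral (F n b - F n a)) {a..b}" for n
    using \<open>a \<le> b\<close> der
    by (intro fundamental_theorem_of_calculus) (auto simp flip: has_real_derivative_iff_has_vector_derivative)
  have conv: "G integrable_on {a..b}" "(\<lambda>n. integral {a..b} (F' n)) \<longlonglongrightarrow> integral {a..b} G"
  proof -
    have i: "F' n integrable_on {a..b}" for n using int by blast
    have B: "(\<lambda>_. B) integrable_on {a..b}" by (rule integrable_const_ivl)
    have n: "norm (F' n s) \<le> B" if "s \<in> {a..b}" for n s using bounded[OF that] by simp
    show "G integrable_on {a..b}" "(\<lambda>n. integral {a..b} (F' n)) \<longlonglongrightarrow> integral {a..b} G"
      using dominated_convergence[OF i B n lim] by blast+
  qed
  have "integral {a..b} G \<le> integral {a..b} (\<lambda>_. 0)"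
    using nonpos by (intro integral_le conv) auto
  moreover have "(\<lambda>n. integral {a..b} (F' n)) \<longlonglongrightarrow> lb - la"
    unfolding integral_unique[OF int] using assms(6,7) by (intro tendsto_diff)
  ultimately show ?thesis using LIMSEQ_unique[OF conv(2)] by fastforce
qed

section \<open>Birth-death equation and growth of weighted squares\<close>

text \<open>The forward operator of the \<open>M/M/1\<close> queue in divergence form: flux from
  \<open>k - 1\<close> to \<open>k\<close> minus flux from \<open>k\<close> to \<open>k + 1\<close>.
  The case \<open>k = 0\<close> says that no flux enters from below, so sums over \<open>k\<close>
  telescope.\<close>

definition birth_death :: "real \<Rightarrow> (nat \<Rightarrow> real) \<Rightarrow> nat \<Rightarrow> real" where
  "birth_death m x k = (if k = 0 then 0 else x (k - 1) - m * x k) - (x k - m * x (Suc k))"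

text \<open>The diagonal terms are nonpositive and dropped, the cross terms are split by
  \<open>2ab \<le> a^2 + b^2\<close>, and moving a square to a neighbouring weight costs a factor
  \<open>R\<close>. The last summand comes from the neighbour \<open>Suc M\<close>, which the
  truncated sum cannot absorb.\<close>

lemma birth_death_weighted_le:
  fixes w x :: "nat \<Rightarrow> real"
  assumes w: "\<And>k. w k \<ge> 0" "\<And>k. w (Suc k) \<le> R * w k" "\<And>k. w k \<le> R * w (Suc k)"
    and x: "\<And>k. x k \<ge> 0" and m: "0 \<le> m" "m \<le> K" and "R \<ge> 0"
  shows "(\<Sum>k\<le>M. w k * (2 * x k * birth_death m x k))
    \<le> (1 + K) * (1 + R) * (\<Sum>k\<le>M. w k * (x k)\<^sup>2) + K * (w M * (x (Suc M))\<^sup>2)"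
proof -
  let ?pr = "\<lambda>k. if k = 0 then 0 else (x (k - 1))\<^sup>2"
  have "2 * x k * birth_death m x k \<le> (1 + K) * (x k)\<^sup>2 + ?pr k + K * (x (Suc k))\<^sup>2" for k
  proof -
    have "2 * x k * birth_death m x k \<le> 2 * x k * (if k = 0 then 0 else x (k - 1)) + m * (2 * x k * x (Suc k))"
      using x[of k] m by (auto simp: birth_death_def algebra_simps)
    also have "2 * x k * (if k = 0 then 0 else x (k - 1)) \<le> (x k)\<^sup>2 + ?pr k"
      using sum_squares_bound[of "x k" "x (k - 1)"] by auto
    also have "m * (2 * x k * x (Suc k)) \<le> K * ((x k)\<^sup>2 + (x (Suc k))\<^sup>2)"
      using sum_squares_bound[of "x k" "x (Suc k)"] x m by (intro mult_mono) auto
    finally show ?thesis by (simp add: algebra_simps)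
  qed
  then have "(\<Sum>k\<le>M. w k * (2 * x k * birth_death m x k))
      \<le> (\<Sum>k\<le>M. w k * ((1 + K) * (x k)\<^sup>2 + ?pr k + K * (x (Suc k))\<^sup>2))"
    by (intro sum_mono mult_left_mono w) auto
  also have "\<dots> = (1 + K) * (\<Sum>k\<le>M. w k * (x k)\<^sup>2) + (\<Sum>k\<le>M. w k * ?pr k)
      + K * (\<Sum>k\<le>M. w k * (x (Suc k))\<^sup>2)"
    by (simp add: distrib_left sum.distrib sum_distrib_left mult_ac)
  also have "(\<Sum>k\<le>M. w k * ?pr k) \<le> R * (\<Sum>k\<le>M. w k * (x k)\<^sup>2)"
  proof -
    have "(\<Sum>k\<le>M. w k * ?pr k) \<le> R * (\<Sum>k<M. w k * (x k)\<^sup>2)"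
    proof (induction M)
      case (Suc M)
      have "w (Suc M) * (x M)\<^sup>2 \<le> R * w M * (x M)\<^sup>2" by (intro mult_right_mono w) auto
      with Suc show ?case by (simp add: algebra_simps)
    qed simp
    also have "\<dots> \<le> R * (\<Sum>k\<le>M. w k * (x k)\<^sup>2)"
      using \<open>R \<ge> 0\<close> w by (intro mult_left_mono sum_mono2) auto
    finally show ?thesis .
  qed
  finally have "(\<Sum>k\<le>M. w k * (2 * x k * birth_death m x k))
    \<le> (1 + K) * (\<Sum>k\<le>M. w k * (x k)\<^sup>2) + R * (\<Sum>k\<le>M. w k * (x k)\<^sup>2)
      + K * (\<Sum>k\<le>M. w k * (x (Suc k))\<^sup>2)" by simp
  moreover have "(\<Sum>k\<le>M. w k * (x (Suc k))\<^sup>2)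
      \<le> R * (\<Sum>k\<le>M. w k * (x k)\<^sup>2) + w M * (x (Suc M))\<^sup>2"
  proof (induction M)
    case 0
    then show ?case using w \<open>R \<ge> 0\<close> by simp
  next
    case (Suc M)
    have "w M * (x (Suc M))\<^sup>2 \<le> R * w (Suc M) * (x (Suc M))\<^sup>2" by (intro mult_right_mono w) auto
    with Suc show ?case by (simp add: algebra_simps)
  qed
  then have "K * (\<Sum>k\<le>M. w k * (x (Suc k))\<^sup>2)
      \<le> K * (R * (\<Sum>k\<le>M. w k * (x k)\<^sup>2) + w M * (x (Suc M))\<^sup>2)"
    using m by (intro mult_left_mono) auto
  ultimately show ?thesis by (simp add: algebra_simps)
qed

text \<open>Finite energy at time 0 stays finite, locally uniformly in time, before any decay is
  known. The bound is uniform in \<open>N\<close>; it is applied with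
  \<open>R = 1 / \<rho>\<close>.\<close>

lemma weighted_l2_growth:
  fixes p :: "nat \<Rightarrow> real \<Rightarrow> real" and m :: "real \<Rightarrow> real"
  assumes ode: "\<And>k s. s \<ge> 0 \<Longrightarrow>
      (p k has_real_derivative birth_death (m s) (\<lambda>j. p j s) k) (at s within {0..})"
    and p: "\<And>k s. 0 \<le> p k s" "\<And>k s. p k s \<le> 1"
    and m: "\<And>s. s \<ge> 0 \<Longrightarrow> 0 \<le> m s" "\<And>s. s \<ge> 0 \<Longrightarrow> m s \<le> K"
    and R: "R > 1" and init: "summable (\<lambda>k. R ^ k * (p k 0)\<^sup>2)" and "t \<ge> 0"
  shows "(\<Sum>k\<le>N. R ^ k * (p k t)\<^sup>2) \<le> exp ((1 + K) * (1 + R) * t) * (\<Sum>k. R ^ k * (p k 0)\<^sup>2)"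
proof -
  \<comment> \<open>Ratios of consecutive weights stay within \<open>[1/R, R]\<close>, and \<open>w\<close> tends to \<open>0\<close>, so that the boundary
    term of the truncated sum disappears in the limit although nothing is known about the tail of \<open>p\<close>.\<close>
  define w where "w k = min (R ^ k) (R ^ (2 * N) * (1 / R) ^ k)" for k
  define C where "C = (1 + K) * (1 + R)"
  have K: "K \<ge> 0" using m[of 0] by simp
  have "C \<ge> 0" using K R by (simp add: C_def)
  have w0: "w k \<ge> 0" for k using R by (simp add: w_def)
  have wR: "w (Suc k) \<le> R * w k" for k
  proof -
    have "(1 / R) * (R ^ (2 * N) * (1 / R) ^ k) \<le> R * (R ^ (2 * N) * (1 / R) ^ k)"
      using R by (intro mult_right_mono) (auto simp: field_simps less_1_mult less_imp_le)
    moreover have "R * w k = min (R * R ^ k) (R * (R ^ (2 * N) * (1 / R) ^ k))"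
      using R by (simp add: w_def min_mult_distrib_left)
    ultimately show ?thesis
      by (simp add: w_def mult.left_commute min.mono min.coboundedI2)
  qed
  have wR': "w k \<le> R * w (Suc k)" for k
  proof -
    have "R ^ k \<le> R * R ^ Suc k"
      using R less_1_mult[of R R] mult_right_mono[of 1 "R * R" "R ^ k"] by (simp add: mult.assoc)
    moreover have "R ^ (2 * N) * (1 / R) ^ k = R * (R ^ (2 * N) * (1 / R) ^ Suc k)"
      using R by (simp add: field_simps)
    moreover have "R * w (Suc k) = min (R * R ^ Suc k) (R * (R ^ (2 * N) * (1 / R) ^ Suc k))"
      using R by (simp add: w_def min_mult_distrib_left)
    ultimately show ?thesis unfolding w_def[of k] by simp
  qed
  have wN: "w k = R ^ k" if "k \<le> N" for k
  proof -
    have "R ^ (2 * N) * (1 / R) ^ k = R ^ (2 * N - k)"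
      using R that power_add[of R "2 * N - k" k] by (simp add: power_one_over)
    moreover have "R ^ k \<le> R ^ (2 * N - k)" using R that by (intro power_increasing) auto
    ultimately show ?thesis by (simp add: w_def min_absorb1)
  qed
  \<comment> \<open>Gronwall with affine term \<open>K * w M\<close>, which dominates the boundary
    term of \<open>birth_death_weighted_le\<close> because \<open>p\<close> is at most 1.\<close>
  have bound: "(\<Sum>k\<le>M. w k * (p k t)\<^sup>2) \<le> exp (C * t) * ((\<Sum>k. R ^ k * (p k 0)\<^sup>2) + K * w M * t)" for M
  proof -
    have "(\<Sum>k\<le>M. w k * (p k t)\<^sup>2) \<le> exp (C * t) * ((\<Sum>k\<le>M. w k * (p k 0)\<^sup>2) + K * w M * t)"
    proof (rule gronwall_affine[where f' = "\<lambda>s. \<Sum>k\<le>M. w k * (2 * p k s * birth_death (m s) (\<lambda>j. p j s) k)"])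
      fix s :: real assume s: "s \<ge> 0"
      show "((\<lambda>s. \<Sum>k\<le>M. w k * (p k s)\<^sup>2) has_real_derivative
          (\<Sum>k\<le>M. w k * (2 * p k s * birth_death (m s) (\<lambda>j. p j s) k))) (at s within {0..})"
      proof (rule DERIV_sum)
        fix k
        show "((\<lambda>s. w k * (p k s)\<^sup>2) has_real_derivative
          w k * (2 * p k s * birth_death (m s) (\<lambda>j. p j s) k)) (at s within {0..})"
          using DERIV_cmult[OF DERIV_power[OF ode[OF s, of k], of 2], of "w k"] by (simp add: mult_ac)
      qed
      have "(\<Sum>k\<le>M. w k * (2 * p k s * birth_death (m s) (\<lambda>j. p j s) k))
        \<le> (1 + K) * (1 + R) * (\<Sum>k\<le>M. w k * (p k s)\<^sup>2) + K * (w M * (p (Suc M) s)\<^sup>2)"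
        using R by (intro birth_death_weighted_le w0 wR wR' p m s) auto
      also have "K * (w M * (p (Suc M) s)\<^sup>2) \<le> K * (w M * 1)"
        using p[of "Suc M" s] K w0 by (intro mult_left_mono) (auto simp: power_le_one)
      finally show "(\<Sum>k\<le>M. w k * (2 * p k s * birth_death (m s) (\<lambda>j. p j s) k))
        \<le> C * (\<Sum>k\<le>M. w k * (p k s)\<^sup>2) + K * w M" by (simp add: C_def)
    qed (use \<open>C \<ge> 0\<close> K w0 \<open>t \<ge> 0\<close> in auto)
    also have "(\<Sum>k\<le>M. w k * (p k 0)\<^sup>2) \<le> (\<Sum>k\<le>M. R ^ k * (p k 0)\<^sup>2)"
      by (intro sum_mono mult_right_mono) (auto simp: w_def)
    also have "\<dots> \<le> (\<Sum>k. R ^ k * (p k 0)\<^sup>2)"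
      using R by (intro sum_le_suminf init) auto
    finally show ?thesis by simp
  qed
  have "(\<lambda>M. R ^ (2 * N) * (1 / R) ^ M) \<longlonglongrightarrow> R ^ (2 * N) * 0"
    using R by (intro tendsto_intros LIMSEQ_power_zero) auto
  then have "w \<longlonglongrightarrow> 0"
    by (intro tendsto_sandwich[of "\<lambda>_. 0" w _ "\<lambda>M. R ^ (2 * N) * (1 / R) ^ M"])
      (auto simp: w0 intro!: always_eventually, auto simp: w_def)
  then have "(\<lambda>M. exp (C * t) * ((\<Sum>k. R ^ k * (p k 0)\<^sup>2) + K * w M * t))
      \<longlonglongrightarrow> exp (C * t) * ((\<Sum>k. R ^ k * (p k 0)\<^sup>2) + K * 0 * t)"
    by (intro tendsto_intros)
  \<comment> \<open>Up to index \<open>N\<close> the weights \<open>w k\<close> equal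
    \<open>R ^ k\<close>, and the further terms up to \<open>M\<close> are nonnegative. So
    \<open>M\<close> can tend to infinity with \<open>N\<close> fixed.\<close>
  moreover have "\<forall>M\<ge>N. (\<Sum>k\<le>N. R ^ k * (p k t)\<^sup>2)
      \<le> exp (C * t) * ((\<Sum>k. R ^ k * (p k 0)\<^sup>2) + K * w M * t)"
  proof (intro allI impI)
    fix M assume "N \<le> M"
    have "(\<Sum>k\<le>N. R ^ k * (p k t)\<^sup>2) = (\<Sum>k\<le>N. w k * (p k t)\<^sup>2)"
      by (intro sum.cong) (auto simp: wN)
    also have "\<dots> \<le> (\<Sum>k\<le>M. w k * (p k t)\<^sup>2)"
      using \<open>N \<le> M\<close> w0 by (intro sum_mono2) auto
    also note bound[of M]
    finally show "(\<Sum>k\<le>N. R ^ k * (p k t)\<^sup>2)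
      \<le> exp (C * t) * ((\<Sum>k. R ^ k * (p k 0)\<^sup>2) + K * w M * t)" .
  qed
  ultimately have "(\<Sum>k\<le>N. R ^ k * (p k t)\<^sup>2) \<le> exp (C * t) * ((\<Sum>k. R ^ k * (p k 0)\<^sup>2) + K * 0 * t)"
    by (blast intro: LIMSEQ_le_const)
  then show ?thesis by (simp add: C_def)
qed

section \<open>The geometric law and its weighted square-summable sequences\<close>

text \<open>The stationary law of the \<open>M/M/1\<close> queue with arrival rate 1 and service
  rate \<open>1 / \<rho>\<close>, as a plain real function because it mostly serves as a weight in
  series.\<close>

definition geo :: "real \<Rightarrow> nat \<Rightarrow> real" where
  "geo \<rho> k = (1 - \<rho>) * \<rho> ^ k"

lemma geo_Suc: "geo \<rho> (Suc k) = \<rho> * geo \<rho> k"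
  by (simp add: geo_def)

lemma geo_pos: "0 < \<rho> \<Longrightarrow> \<rho> < 1 \<Longrightarrow> 0 < geo \<rho> k"
  by (simp add: geo_def)

lemma geo_sums: "0 < \<rho> \<Longrightarrow> \<rho> < 1 \<Longrightarrow> geo \<rho> sums 1"
  using sums_mult[OF geometric_sums[of \<rho>], of "1 - \<rho>"] by (simp add: geo_def[abs_def])

text \<open>Membership in the Hilbert space \<open>L^2\<close> of the law \<open>geo \<rho>\<close>.
  The closure properties that follow supply the convergence of the series in the energy
  computation.\<close>

definition wl2 :: "real \<Rightarrow> (nat \<Rightarrow> real) \<Rightarrow> bool" where
  "wl2 \<rho> x \<longleftrightarrow> summable (\<lambda>k. geo \<rho> k * (x k)\<^sup>2)"

context
  fixes \<rho> :: real
  assumes \<rho>: "0 < \<rho>" "\<rho> < 1"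
begin

lemma wl2_mult:
  assumes "wl2 \<rho> x" "wl2 \<rho> y"
  shows "summable (\<lambda>k. geo \<rho> k * (x k * y k))"
proof (rule summable_comparison_test')
  show "summable (\<lambda>k. geo \<rho> k * (x k)\<^sup>2 + geo \<rho> k * (y k)\<^sup>2)"
    using assms unfolding wl2_def by (rule summable_add)
  fix k
  have "\<bar>x k * y k\<bar> \<le> (x k)\<^sup>2 + (y k)\<^sup>2"
    using sum_squares_bound[of "\<bar>x k\<bar>" "\<bar>y k\<bar>"] by (auto simp: abs_mult intro: order_trans[rotated])
  then show "norm (geo \<rho> k * (x k * y k)) \<le> geo \<rho> k * (x k)\<^sup>2 + geo \<rho> k * (y k)\<^sup>2"
    using geo_pos[OF \<rho>, of k] by (simp add: abs_mult flip: distrib_left)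
qed

lemma wl2_const: "wl2 \<rho> (\<lambda>_. c)"
  unfolding wl2_def using geo_sums[OF \<rho>] by (intro summable_mult2) (rule sums_summable)

lemma wl2_cmult: "wl2 \<rho> x \<Longrightarrow> wl2 \<rho> (\<lambda>k. c * x k)"
  unfolding wl2_def power_mult_distrib
  by (drule summable_mult[of _ "c\<^sup>2"]) (simp add: mult.left_commute)

lemma wl2_add:
  assumes "wl2 \<rho> x" "wl2 \<rho> y"
  shows "wl2 \<rho> (\<lambda>k. x k + y k)"
proof -
  have "summable (\<lambda>k. geo \<rho> k * (x k)\<^sup>2 + geo \<rho> k * (y k)\<^sup>2 + 2 * (geo \<rho> k * (x k * y k)))"
    using assms wl2_mult[OF assms] unfolding wl2_def by (intro summable_add summable_mult)
  then show ?thesis by (simp add: wl2_def power2_sum algebra_simps)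
qed

lemma wl2_diff: "wl2 \<rho> x \<Longrightarrow> wl2 \<rho> y \<Longrightarrow> wl2 \<rho> (\<lambda>k. x k - y k)"
  using wl2_add[OF _ wl2_cmult[of y "-1"]] by simp

lemma wl2_Suc:
  assumes "wl2 \<rho> x"
  shows "wl2 \<rho> (\<lambda>k. x (Suc k))"
proof -
  have "summable (\<lambda>k. geo \<rho> (Suc k) * (x (Suc k))\<^sup>2)"
    using assms by (simp add: wl2_def summable_Suc_iff[of "\<lambda>k. geo \<rho> k * (x k)\<^sup>2"])
  from summable_mult[OF this, of "1 / \<rho>"] show ?thesis
    using \<rho> by (simp add: wl2_def geo_Suc mult.assoc)
qed

section \<open>Poincare inequality and energy dissipation\<close>

text \<open>Summation by parts writes the energy as the sum of
  \<open>T k * (g (Suc k) - g k)\<close> up to a boundary term. Young's inequality splits twice this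
  sum into the dissipation over \<open>(c - 1)\<^sup>2\<close> and \<open>(c - 1)\<^sup>2\<close>
  times the sum of \<open>(T k)\<^sup>2 / geo \<rho> k\<close>. A discrete Hardy inequality bounds
  the latter by one copy of the energy, so one of the two copies survives on the left.\<close>

lemma poincare_truncated:
  fixes g T :: "nat \<Rightarrow> real" and c :: real
  assumes c: "c > 1" "\<rho> = 1 / c\<^sup>2"
    and T: "\<And>k. T k = - (\<Sum>j\<le>k. geo \<rho> j * g j)"
  shows "(\<Sum>k\<le>N. geo \<rho> k * (g k)\<^sup>2) \<le> (\<Sum>k<N. geo \<rho> k * (g (Suc k) - g k)\<^sup>2) / (c - 1)\<^sup>2
    + (c - 1) * ((T N)\<^sup>2 / geo \<rho> N) - 2 * (g N * T N)"
proof -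
  define z where "z k = (T k)\<^sup>2 / geo \<rho> k" for k
  let ?d = "\<lambda>k. g (Suc k) - g k"
  let ?E = "\<Sum>k\<le>N. geo \<rho> k * (g k)\<^sup>2"
  have pos: "geo \<rho> k > 0" for k using geo_pos[OF \<rho>] .
  have T_Suc: "geo \<rho> (Suc k) * g (Suc k) = T k - T (Suc k)" for k by (simp add: T)
  have parts: "?E = (\<Sum>k<N. T k * ?d k) - g N * T N"
  proof (induction N)
    case (Suc N)
    have "geo \<rho> (Suc N) * (g (Suc N))\<^sup>2 = (T N - T (Suc N)) * g (Suc N)"
      by (simp flip: T_Suc add: power2_eq_square)
    with Suc show ?case by (simp add: algebra_simps)
  qed (simp add: T power2_eq_square)
  \<comment> \<open>The correction \<open>(c - 1) * z N\<close> telescopes, so each induction step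
    reduces to an inequality between two consecutive values of \<open>T\<close>.\<close>
  have hardy: "(c - 1)\<^sup>2 * (\<Sum>k<N. z k) \<le> ?E + (c - 1) * z N"
  proof (induction N)
    case 0
    have "z 0 \<ge> 0" using pos[of 0] by (simp add: z_def)
    then show ?case using c pos[of 0] by (simp add: less_imp_le)
  next
    case (Suc N)
    have "(c - 1)\<^sup>2 * z N + (c - 1) * z N - (c - 1) * z (Suc N) \<le> geo \<rho> (Suc N) * (g (Suc N))\<^sup>2"
    proof -
      define a b P where "a = T N" and "b = T (Suc N)" and "P = geo \<rho> N"
      have P: "P > 0" "geo \<rho> (Suc N) = P / c\<^sup>2" using pos by (auto simp: P_def geo_Suc c)
      have g: "g (Suc N) = (a - b) * c\<^sup>2 / P"
      proof -
        have "P / c\<^sup>2 * g (Suc N) = a - b" using T_Suc[of N] unfolding P(2) a_def b_def .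
        then show ?thesis using P(1) c by (simp add: field_simps)
      qed
      have "geo \<rho> (Suc N) * (g (Suc N))\<^sup>2 = (c\<^sup>2 * (a - b)\<^sup>2) / P"
        unfolding P(2) g using P(1) c by (simp add: power2_eq_square field_simps)
      moreover have "(c - 1)\<^sup>2 * z N + (c - 1) * z N - (c - 1) * z (Suc N)
          = (((c - 1)\<^sup>2 + (c - 1)) * a\<^sup>2 - (c - 1) * c\<^sup>2 * b\<^sup>2) / P"
      proof -
        have "z N = a\<^sup>2 / P" "z (Suc N) = c\<^sup>2 * b\<^sup>2 / P"
          using P(2) c(1) by (simp_all add: z_def a_def b_def P_def)
        then show ?thesis by (simp add: diff_divide_distrib add_divide_distrib distrib_right)
      qed
      moreover have "((c - 1)\<^sup>2 + (c - 1)) * a\<^sup>2 - (c - 1) * c\<^sup>2 * b\<^sup>2 \<le> c\<^sup>2 * (a - b)\<^sup>2"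
      proof -
        \<comment> \<open>Equality would require \<open>T N = c * T (Suc N)\<close>, that is, decay
          of \<open>T\<close> by the factor \<open>sqrt \<rho>\<close> per step. This critical
          profile is the source of the constant \<open>(c - 1)\<^sup>2\<close>.\<close>
        have square: "c\<^sup>2 * (a - b)\<^sup>2 - (((c - 1)\<^sup>2 + (c - 1)) * a\<^sup>2 - (c - 1) * c\<^sup>2 * b\<^sup>2)
            = c * (a - c * b)\<^sup>2"
          by (simp add: power2_eq_square algebra_simps)
        have "0 \<le> c * (a - c * b)\<^sup>2" using c(1) by simp
        then show ?thesis unfolding square[symmetric] diff_ge_0_iff_ge .
      qed
      ultimately show ?thesis using P by (simp add: divide_right_mono)
    qed
    with Suc show ?case by (simp add: algebra_simps)
  qed
  have "2 * (\<Sum>k<N. T k * ?d k)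
      \<le> (c - 1)\<^sup>2 * (\<Sum>k<N. z k) + (\<Sum>k<N. geo \<rho> k * (?d k)\<^sup>2) / (c - 1)\<^sup>2"
    unfolding sum_distrib_left sum_divide_distrib sum.distrib[symmetric]
  proof (rule sum_mono)
    fix k
    have "0 \<le> ((c - 1) * T k - geo \<rho> k * ?d k / (c - 1))\<^sup>2 / geo \<rho> k"
      using pos[of k] by simp
    also have "\<dots> = (c - 1)\<^sup>2 * z k + geo \<rho> k * (?d k)\<^sup>2 / (c - 1)\<^sup>2 - 2 * (T k * ?d k)"
    proof -
      have "(q * a - P * b / q)\<^sup>2 / P = q\<^sup>2 * (a\<^sup>2 / P) + P * b\<^sup>2 / q\<^sup>2 - 2 * (a * b)"
        if "P > 0" "q > 0" for q a P b :: real
        using that by (simp add: power2_eq_square field_simps)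
      from this[OF pos] c show ?thesis by (simp add: z_def)
    qed
    finally show "2 * (T k * ?d k) \<le> (c - 1)\<^sup>2 * z k + geo \<rho> k * (?d k)\<^sup>2 / (c - 1)\<^sup>2" by simp
  qed
  with parts hardy show ?thesis unfolding z_def[of N, symmetric] by linarith
qed

lemma poincare_geo:
  assumes c: "c > 1" "\<rho> = 1 / c\<^sup>2" and g: "wl2 \<rho> g" and mean: "(\<lambda>k. geo \<rho> k * g k) sums 0"
  shows "(c - 1)\<^sup>2 * (\<Sum>k. geo \<rho> k * (g k)\<^sup>2) \<le> (\<Sum>k. geo \<rho> k * (g (Suc k) - g k)\<^sup>2)"
proof -
  \<comment> \<open>As \<open>g\<close> has mean \<open>0\<close>, \<open>T\<close> is also a tail sum, and hence small enough for the boundary terms of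
    \<open>poincare_truncated\<close> to vanish.\<close>
  define T where "T k = - (\<Sum>j\<le>k. geo \<rho> j * g j)" for k
  define e where "e k = geo \<rho> k * (g k)\<^sup>2" for k
  have pos: "geo \<rho> k > 0" for k using geo_pos[OF \<rho>] .
  have e: "summable e" "e k \<ge> 0" for k
    using g pos[of k] by (auto simp: e_def[abs_def] wl2_def)
  \<comment> \<open>As the full sum is 0, \<open>T N\<close> is the sum over \<open>j > N\<close>.
    Cauchy-Schwarz against the tail mass \<open>\<rho> ^ Suc N\<close> leaves the tail of the energy
    series, which tends to 0.\<close>
  have tail: "(T N)\<^sup>2 / geo \<rho> N \<le> (\<Sum>k. e k) / (1 - \<rho>) - (\<Sum>k\<le>N. e k) / (1 - \<rho>)" for N
  proof -
    have "(\<Sum>j=Suc N..M. geo \<rho> j * g j)\<^sup>2 \<le> \<rho> ^ Suc N * ((\<Sum>k. e k) - (\<Sum>k\<le>N. e k))" if "M \<ge> N" for M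
    proof -
      have split: "{..M} = {..N} \<union> {Suc N..M}" "{..N} \<inter> {Suc N..M} = {}" using that by auto
      have "(\<Sum>j=Suc N..M. geo \<rho> j * g j)\<^sup>2
          = (\<Sum>j=Suc N..M. sqrt (geo \<rho> j) * (sqrt (geo \<rho> j) * g j))\<^sup>2"
        using pos by (simp add: less_imp_le flip: mult.assoc)
      also have "\<dots> \<le> (\<Sum>j=Suc N..M. (sqrt (geo \<rho> j))\<^sup>2) * (\<Sum>j=Suc N..M. (sqrt (geo \<rho> j) * g j)\<^sup>2)"
        by (rule Cauchy_Schwarz_ineq_sum)
      also have "\<dots> = (\<Sum>j=Suc N..M. geo \<rho> j) * (\<Sum>j=Suc N..M. e j)"
        using pos by (simp add: e_def power_mult_distrib less_imp_le)
      also have "\<dots> \<le> \<rho> ^ Suc N * ((\<Sum>k. e k) - (\<Sum>k\<le>N. e k))"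
      proof (rule mult_mono)
        have "(\<Sum>j=Suc N..M. geo \<rho> j) = \<rho> ^ Suc N - \<rho> ^ Suc M"
          using that by (induction M rule: dec_induct) (auto simp: geo_def algebra_simps)
        then show "(\<Sum>j=Suc N..M. geo \<rho> j) \<le> \<rho> ^ Suc N" using \<rho> by simp
        have "(\<Sum>k\<le>N. e k) + (\<Sum>j=Suc N..M. e j) = (\<Sum>k\<le>M. e k)"
          by (simp add: split sum.union_disjoint)
        also have "\<dots> \<le> (\<Sum>k. e k)" using e by (intro sum_le_suminf) auto
        finally show "(\<Sum>j=Suc N..M. e j) \<le> (\<Sum>k. e k) - (\<Sum>k\<le>N. e k)" by simp
      qed (use \<rho> e in \<open>auto intro!: sum_nonneg\<close>)
      finally show ?thesis .
    qed
    moreover have "(\<Sum>j=Suc N..M. geo \<rho> j * g j) = T N - T M" if "M \<ge> N" for M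
      using that by (induction M rule: dec_induct) (auto simp: T_def)
    ultimately have "\<forall>M\<ge>N. (T N - T M)\<^sup>2 \<le> \<rho> ^ Suc N * ((\<Sum>k. e k) - (\<Sum>k\<le>N. e k))" by simp
    moreover have "T \<longlonglongrightarrow> - 0"
      using mean unfolding T_def sums_def_le by (rule tendsto_minus)
    then have "T \<longlonglongrightarrow> 0" by simp
    then have "(\<lambda>M. (T N - T M)\<^sup>2) \<longlonglongrightarrow> (T N - 0)\<^sup>2" by (intro tendsto_intros)
    ultimately have "(T N - 0)\<^sup>2 \<le> \<rho> ^ Suc N * ((\<Sum>k. e k) - (\<Sum>k\<le>N. e k))"
      by (blast intro: LIMSEQ_le_const2)
    \<comment> \<open>One factor \<rho> is given away so that the power matches the one in
      \<open>geo \<rho> N\<close>.\<close>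
    also have "\<dots> \<le> \<rho> ^ N * ((\<Sum>k. e k) - (\<Sum>k\<le>N. e k))"
      using \<rho> e by (intro mult_right_mono) (auto intro!: sum_le_suminf simp: mult_left_le_one_le)
    finally have "(T N)\<^sup>2 / \<rho> ^ N \<le> (\<Sum>k. e k) - (\<Sum>k\<le>N. e k)"
      using \<rho> by (simp add: pos_divide_le_eq mult.commute)
    then have "(T N)\<^sup>2 / \<rho> ^ N / (1 - \<rho>) \<le> ((\<Sum>k. e k) - (\<Sum>k\<le>N. e k)) / (1 - \<rho>)"
      using \<rho> by (intro divide_right_mono) auto
    then show ?thesis by (simp add: geo_def diff_divide_distrib mult.commute)
  qed
  have "(\<lambda>N. (\<Sum>k. e k) / (1 - \<rho>) - (\<Sum>k\<le>N. e k) / (1 - \<rho>))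
      \<longlonglongrightarrow> (\<Sum>k. e k) / (1 - \<rho>) - (\<Sum>k. e k) / (1 - \<rho>)"
    using \<rho> by (intro tendsto_diff tendsto_const tendsto_divide summable_LIMSEQ' e) auto
  then have tail_lim: "(\<lambda>N. (\<Sum>k. e k) / (1 - \<rho>) - (\<Sum>k\<le>N. e k) / (1 - \<rho>)) \<longlonglongrightarrow> 0"
    by simp
  have z: "(\<lambda>N. (T N)\<^sup>2 / geo \<rho> N) \<longlonglongrightarrow> 0"
  proof (rule tendsto_sandwich[OF _ _ tendsto_const tail_lim])
    show "\<forall>\<^sub>F N in sequentially. 0 \<le> (T N)\<^sup>2 / geo \<rho> N"
      using pos by (intro always_eventually allI divide_nonneg_pos) auto
    show "\<forall>\<^sub>F N in sequentially. (T N)\<^sup>2 / geo \<rho> N \<le> (\<Sum>k. e k) / (1 - \<rho>) - (\<Sum>k\<le>N. e k) / (1 - \<rho>)"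
      by (intro always_eventually allI tail)
  qed
  have gT: "(\<lambda>N. g N * T N) \<longlonglongrightarrow> 0"
  proof (rule tendsto_rabs_zero_cancel, rule tendsto_sandwich[OF _ _ tendsto_const[of 0]])
    \<comment> \<open>Young's inequality: the product is dominated by the general term of a
      convergent series plus the null sequence from \<open>z\<close>.\<close>
    have "\<bar>g N * T N\<bar> \<le> e N + (T N)\<^sup>2 / geo \<rho> N" for N
    proof -
      have "0 \<le> (geo \<rho> N * \<bar>g N\<bar> - \<bar>T N\<bar>)\<^sup>2 / geo \<rho> N" using pos[of N] by simp
      also have "\<dots> = e N + (T N)\<^sup>2 / geo \<rho> N - 2 * \<bar>g N * T N\<bar>"
        using pos[of N] by (simp add: e_def power2_diff power_mult_distrib abs_mult field_simps)
          (simp add: power2_eq_square)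
      finally show ?thesis using abs_ge_zero[of "g N * T N"] by linarith
    qed
    then show "\<forall>\<^sub>F N in sequentially. \<bar>g N * T N\<bar> \<le> e N + (T N)\<^sup>2 / geo \<rho> N" by simp
    show "(\<lambda>N. e N + (T N)\<^sup>2 / geo \<rho> N) \<longlonglongrightarrow> 0"
      using tendsto_add[OF summable_LIMSEQ_zero[OF e(1)] z] by simp
  qed auto
  have D: "summable (\<lambda>k. geo \<rho> k * (g (Suc k) - g k)\<^sup>2)"
    using wl2_diff[OF wl2_Suc[OF g] g] by (simp add: wl2_def)
  have "(\<lambda>N. (\<Sum>k<N. geo \<rho> k * (g (Suc k) - g k)\<^sup>2) / (c - 1)\<^sup>2
    + (c - 1) * ((T N)\<^sup>2 / geo \<rho> N) - 2 * (g N * T N))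
    \<longlonglongrightarrow> (\<Sum>k. geo \<rho> k * (g (Suc k) - g k)\<^sup>2) / (c - 1)\<^sup>2 + (c - 1) * 0 - 2 * 0"
    using c by (intro tendsto_diff tendsto_add tendsto_mult tendsto_const tendsto_divide summable_LIMSEQ z gT D) auto
  moreover have "(\<lambda>N. \<Sum>k\<le>N. e k) \<longlonglongrightarrow> (\<Sum>k. e k)" using e(1) by (rule summable_LIMSEQ')
  ultimately have "(\<Sum>k. e k) \<le> (\<Sum>k. geo \<rho> k * (g (Suc k) - g k)\<^sup>2) / (c - 1)\<^sup>2 + (c - 1) * 0 - 2 * 0"
    using poincare_truncated[OF c T_def] by (intro LIMSEQ_le) (auto simp: e_def)
  then show ?thesis using c(1) by (simp add: e_def field_simps)
qed

text \<open>As \<open>g\<close> has mean \<open>0\<close>, the part of the perturbation that is linear in \<open>g\<close> telescopes to \<open>2 \<delta> \<pi>\<^sub>0 g\<^sub>0\<close>.\<close>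

lemma energy_dissipation:
  assumes g: "wl2 \<rho> g" and mean: "(\<lambda>k. geo \<rho> k * g k) sums 0"
    and p: "\<And>k. p k = geo \<rho> k * (1 + g k)"
  shows "\<exists>A. (\<lambda>k. 2 * g k * birth_death (1 / \<rho> + \<delta>) p k) sums A \<and>
    A \<le> - 2 * (\<Sum>k. geo \<rho> k * (g (Suc k) - g k)\<^sup>2) + 2 * \<bar>\<delta>\<bar> * \<bar>geo \<rho> 0 * g 0\<bar>
      + \<bar>\<delta>\<bar> * ((\<Sum>k. geo \<rho> k * (g k)\<^sup>2) + (\<Sum>k. geo \<rho> k * (g (Suc k) - g k)\<^sup>2))"
proof -
  define d where "d k = g (Suc k) - g k" for k
  \<comment> \<open>The flux divided by \<open>geo \<rho> k\<close>: the rate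
    \<open>1 / \<rho>\<close> contributes \<open>- d k\<close>, the excess \<delta> the rest.
    Writing \<open>- 1 * d k\<close> lets \<open>wl2_cmult\<close> apply.\<close>
  define j where "j k = - 1 * d k - \<delta> * \<rho> * (1 + g (Suc k))" for k
  let ?E = "\<Sum>k. geo \<rho> k * (g k)\<^sup>2" and ?D = "\<Sum>k. geo \<rho> k * (d k)\<^sup>2"
  have pos: "geo \<rho> k > 0" for k using geo_pos[OF \<rho>] .
  have gS: "wl2 \<rho> (\<lambda>k. g (Suc k))" using wl2_Suc[OF g] .
  have d: "wl2 \<rho> d" unfolding d_def[abs_def] by (intro wl2_diff gS g)
  have j: "wl2 \<rho> j" unfolding j_def[abs_def] by (intro wl2_diff wl2_cmult wl2_add wl2_const d gS)
  define m where "m = 1 / \<rho> + \<delta>"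
  have flux: "p k - m * p (Suc k) = geo \<rho> k * j k" for k
    using \<rho> by (simp add: m_def p geo_Suc j_def d_def field_simps)
  have v: "birth_death m p k
      = (if k = 0 then 0 else geo \<rho> (k - 1) * j (k - 1)) - geo \<rho> k * j k" for k
    by (cases k) (simp_all add: birth_death_def flip: flux)
  \<comment> \<open>Summation by parts; the boundary term is the general term of a summable series
    and vanishes in the limit.\<close>
  have parts: "(\<Sum>k\<le>N. 2 * g k * birth_death m p k)
      = 2 * (\<Sum>k\<le>N. geo \<rho> k * (d k * j k)) - 2 * (geo \<rho> N * (g (Suc N) * j N))" for N
    by (induction N) (simp_all add: v d_def algebra_simps)
  define X where "X = (\<Sum>k. geo \<rho> k * (d k * j k))"
  have lim: "(\<lambda>k. 2 * g k * birth_death m p k) sums (2 * X - 2 * 0)"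
    unfolding sums_def_le parts X_def
    by (intro tendsto_diff tendsto_mult tendsto_const summable_LIMSEQ' summable_LIMSEQ_zero wl2_mult d j gS)
  \<comment> \<open>Removing index 0 from the mean-zero sum leaves
    \<open>- (geo \<rho> 0 * g 0)\<close>. Hence the sum of \<open>geo \<rho> k * d k\<close>
    depends on \<open>g 0\<close> alone.\<close>
  have meanS: "(\<lambda>k. geo \<rho> k * g (Suc k)) sums (- (geo \<rho> 0 * g 0) / \<rho>)"
  proof -
    have "(\<lambda>k. geo \<rho> (Suc k) * g (Suc k)) sums (0 - geo \<rho> 0 * g 0)"
      using mean by (subst sums_Suc_iff) simp
    from sums_divide[OF this, of \<rho>] show ?thesis using \<rho> by (simp add: geo_Suc)
  qed
  have "(\<lambda>k. geo \<rho> k * (g (Suc k) * 1) - geo \<rho> k * (g k * 1)) sums (- (geo \<rho> 0 * g 0) / \<rho> - 0)"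
    using sums_diff[OF meanS mean] by simp
  then have dsum: "(\<lambda>k. geo \<rho> k * d k) sums (- (geo \<rho> 0 * g 0) / \<rho>)"
    by (simp add: d_def algebra_simps)
  define Y where "Y = (\<Sum>k. geo \<rho> k * (g (Suc k) * d k))"
  have "(\<lambda>k. - (geo \<rho> k * (d k)\<^sup>2) - \<delta> * \<rho> * (geo \<rho> k * d k) - \<delta> * \<rho> * (geo \<rho> k * (g (Suc k) * d k)))
     sums (- ?D - \<delta> * \<rho> * (- (geo \<rho> 0 * g 0) / \<rho>) - \<delta> * \<rho> * Y)"
    unfolding Y_def
    by (intro sums_diff sums_minus sums_mult dsum summable_sums wl2_mult gS d d[unfolded wl2_def])
  moreover have "- (geo \<rho> k * (d k)\<^sup>2) - \<delta> * \<rho> * (geo \<rho> k * d k) - \<delta> * \<rho> * (geo \<rho> k * (g (Suc k) * d k))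
      = geo \<rho> k * (d k * j k)" for k
    by (simp add: j_def power2_eq_square algebra_simps)
  ultimately have X: "X = - ?D + \<delta> * (geo \<rho> 0 * g 0) - \<delta> * (\<rho> * Y)"
    using \<rho> by (simp add: X_def sums_iff)
  \<comment> \<open>The factor \<rho> turns the weight \<open>geo \<rho> k\<close> into
    \<open>geo \<rho> (Suc k)\<close>, so the shifted squares form a part of
    \<open>?E\<close>.\<close>
  have Y: "\<rho> * \<bar>Y\<bar> \<le> (?E + ?D) / 2"
  proof -
    have s: "summable (\<lambda>k. \<bar>geo \<rho> k * (g (Suc k) * d k)\<bar>)"
    proof -
      have "wl2 \<rho> (\<lambda>k. \<bar>g (Suc k)\<bar>)" "wl2 \<rho> (\<lambda>k. \<bar>d k\<bar>)" using gS d by (simp_all add: wl2_def)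
      from wl2_mult[OF this] show ?thesis using pos by (simp add: abs_mult less_imp_le)
    qed
    have sE: "(\<lambda>k. geo \<rho> (Suc k) * (g (Suc k))\<^sup>2) sums (?E - geo \<rho> 0 * (g 0)\<^sup>2)"
      using g by (subst sums_Suc_iff) (simp add: wl2_def summable_sums)
    have sD: "(\<lambda>k. geo \<rho> k * (d k)\<^sup>2) sums ?D" using d by (simp add: wl2_def summable_sums)
    have "\<rho> * \<bar>Y\<bar> \<le> \<rho> * (\<Sum>k. \<bar>geo \<rho> k * (g (Suc k) * d k)\<bar>)"
      unfolding Y_def using s \<rho> by (intro mult_left_mono summable_rabs) auto
    also have "\<dots> = (\<Sum>k. \<rho> * \<bar>geo \<rho> k * (g (Suc k) * d k)\<bar>)"
      using s by (simp add: suminf_mult)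
    also have "\<dots> \<le> (\<Sum>k. (geo \<rho> (Suc k) * (g (Suc k))\<^sup>2 + geo \<rho> k * (d k)\<^sup>2) / 2)"
    proof (rule suminf_le)
      fix k
      have "2 * (\<bar>g (Suc k)\<bar> * \<bar>d k\<bar>) \<le> (g (Suc k))\<^sup>2 + (d k)\<^sup>2"
        using sum_squares_bound[of "\<bar>g (Suc k)\<bar>" "\<bar>d k\<bar>"] by (simp add: mult.assoc)
      then have "\<rho> * geo \<rho> k * (2 * (\<bar>g (Suc k)\<bar> * \<bar>d k\<bar>)) \<le> \<rho> * geo \<rho> k * ((g (Suc k))\<^sup>2 + (d k)\<^sup>2)"
        using \<rho> pos[of k] by (intro mult_left_mono) auto
      moreover have "\<rho> * (geo \<rho> k * (d k)\<^sup>2) \<le> geo \<rho> k * (d k)\<^sup>2"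
        using \<rho> pos[of k] by (intro mult_left_le_one_le) auto
      then have "\<rho> * geo \<rho> k * (2 * (\<bar>g (Suc k)\<bar> * \<bar>d k\<bar>)) / 2
          \<le> (geo \<rho> (Suc k) * (g (Suc k))\<^sup>2 + geo \<rho> k * (d k)\<^sup>2) / 2"
        if "\<rho> * geo \<rho> k * (2 * (\<bar>g (Suc k)\<bar> * \<bar>d k\<bar>)) \<le> geo \<rho> (Suc k) * (g (Suc k))\<^sup>2 + \<rho> * (geo \<rho> k * (d k)\<^sup>2)"
        using that by (intro divide_right_mono) (auto intro: order_trans)
      moreover have "\<rho> * \<bar>geo \<rho> k * (g (Suc k) * d k)\<bar> = \<rho> * geo \<rho> k * (2 * (\<bar>g (Suc k)\<bar> * \<bar>d k\<bar>)) / 2"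
        using pos[of k] by (simp add: abs_mult)
      moreover have "\<rho> * geo \<rho> k * ((g (Suc k))\<^sup>2 + (d k)\<^sup>2)
          = geo \<rho> (Suc k) * (g (Suc k))\<^sup>2 + \<rho> * (geo \<rho> k * (d k)\<^sup>2)"
        by (simp add: geo_Suc distrib_left mult.assoc)
      ultimately show "\<rho> * \<bar>geo \<rho> k * (g (Suc k) * d k)\<bar>
          \<le> (geo \<rho> (Suc k) * (g (Suc k))\<^sup>2 + geo \<rho> k * (d k)\<^sup>2) / 2"
        by (simp only:)
    next
      show "summable (\<lambda>k. \<rho> * \<bar>geo \<rho> k * (g (Suc k) * d k)\<bar>)" by (rule summable_mult[OF s])
      show "summable (\<lambda>k. (geo \<rho> (Suc k) * (g (Suc k))\<^sup>2 + geo \<rho> k * (d k)\<^sup>2) / 2)"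
        using sums_divide[OF sums_add[OF sE sD], of 2] by (rule sums_summable)
    qed
    also have "\<dots> = (?E - geo \<rho> 0 * (g 0)\<^sup>2 + ?D) / 2"
      using sums_divide[OF sums_add[OF sE sD], of 2] by (simp add: sums_iff)
    also have "\<dots> \<le> (?E + ?D) / 2" using pos[of 0] by simp
    finally show ?thesis .
  qed
  have "\<delta> * (geo \<rho> 0 * g 0) \<le> \<bar>\<delta>\<bar> * \<bar>geo \<rho> 0 * g 0\<bar>" by (simp flip: abs_mult)
  moreover have "- (\<delta> * (\<rho> * Y)) \<le> \<bar>\<delta>\<bar> * ((?E + ?D) / 2)"
  proof -
    have "- (\<delta> * (\<rho> * Y)) \<le> \<bar>\<delta>\<bar> * (\<rho> * \<bar>Y\<bar>)"
      using \<rho> abs_ge_minus_self[of "\<delta> * (\<rho> * Y)"] by (simp add: abs_mult)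
    also have "\<dots> \<le> \<bar>\<delta>\<bar> * ((?E + ?D) / 2)" using Y by (intro mult_left_mono) auto
    finally show ?thesis .
  qed
  ultimately have "2 * X \<le> - 2 * ?D + 2 * \<bar>\<delta>\<bar> * \<bar>geo \<rho> 0 * g 0\<bar> + \<bar>\<delta>\<bar> * (?E + ?D)"
    unfolding X by simp
  with lim show ?thesis by (auto simp: d_def m_def)
qed

end

section \<open>Energy decay along the flow\<close>

text \<open>Used to dominate the time derivative of the truncated energies. The square of a
  three-term sum costs the factor 3. The term in \<open>x (k - 1)\<close> costs
  \<open>1 / \<rho>\<close> for the change of weight, while the one in \<open>x (Suc k)\<close>
  costs nothing because \<open>geo \<rho>\<close> is decreasing.\<close>

lemma birth_death_weighted_square_sum_le:
  assumes \<rho>: "0 < \<rho>" "\<rho> < 1" and m: "0 \<le> m" "m \<le> K" and x: "\<And>k. x k \<ge> 0"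
    and B: "\<And>n. (\<Sum>k<n. (x k)\<^sup>2 / geo \<rho> k) \<le> B"
  shows "(\<Sum>k<n. (birth_death m x k)\<^sup>2 / geo \<rho> k) \<le> 3 * (1 / \<rho> + (1 + K)\<^sup>2 + K\<^sup>2) * B"
proof -
  define a where "a k = (x k)\<^sup>2 / geo \<rho> k" for k
  define b where "b k = (if k = 0 then 0 else a (k - 1) / \<rho>)" for k
  have pos: "geo \<rho> k > 0" for k using geo_pos[OF \<rho>] .
  have a: "a k \<ge> 0" for k using pos[of k] by (simp add: a_def less_imp_le)
  have K: "K \<ge> 0" using m by simp
  have pointwise: "(birth_death m x k)\<^sup>2 / geo \<rho> k \<le> 3 * (b k + (1 + K)\<^sup>2 * a k + K\<^sup>2 * a (Suc k))" for k
  proof -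
    define y where "y = (if k = 0 then 0 else x (k - 1))"
    have "y \<ge> 0" using x by (simp add: y_def)
    have "\<bar>birth_death m x k\<bar> \<le> y + (1 + K) * x k + K * x (Suc k)"
    proof -
      have "0 \<le> m * x k" "m * x k \<le> K * x k" "0 \<le> m * x (Suc k)" "m * x (Suc k) \<le> K * x (Suc k)"
        using m x by (auto intro: mult_right_mono)
      then show ?thesis using x[of k] x[of "Suc k"] x[of "k - 1"]
        by (auto simp: birth_death_def y_def algebra_simps abs_le_iff)
    qed
    then have "(birth_death m x k)\<^sup>2 \<le> (y + (1 + K) * x k + K * x (Suc k))\<^sup>2"
      by (metis abs_ge_zero power2_abs power_mono)
    also have "\<dots> \<le> 3 * (y\<^sup>2 + ((1 + K) * x k)\<^sup>2 + (K * x (Suc k))\<^sup>2)"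
    proof -
      have "(u + v + w)\<^sup>2 \<le> 3 * (u\<^sup>2 + v\<^sup>2 + w\<^sup>2)" for u v w :: real
        using sum_squares_bound[of u v] sum_squares_bound[of u w] sum_squares_bound[of v w]
        by (simp add: power2_eq_square algebra_simps)
      then show ?thesis .
    qed
    finally have "(birth_death m x k)\<^sup>2 / geo \<rho> k
        \<le> 3 * (y\<^sup>2 + ((1 + K) * x k)\<^sup>2 + (K * x (Suc k))\<^sup>2) / geo \<rho> k"
      using pos[of k] by (intro divide_right_mono) auto
    also have "\<dots> = 3 * (y\<^sup>2 / geo \<rho> k + (1 + K)\<^sup>2 * a k + K\<^sup>2 * ((x (Suc k))\<^sup>2 / geo \<rho> k))"
      by (simp add: a_def add_divide_distrib distrib_left power_mult_distrib)
    also have "\<dots> \<le> 3 * (b k + (1 + K)\<^sup>2 * a k + K\<^sup>2 * a (Suc k))"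
    proof -
      have "y\<^sup>2 / geo \<rho> k = b k"
        by (cases k) (simp_all add: y_def b_def a_def geo_Suc mult.commute)
      moreover have "(x (Suc k))\<^sup>2 / geo \<rho> k \<le> a (Suc k)"
        unfolding a_def using \<rho> pos[of k]
        by (intro divide_left_mono) (auto simp: geo_Suc mult_left_le_one_le)
      ultimately show ?thesis by (intro mult_left_mono add_mono) auto
    qed
    finally show ?thesis .
  qed
  have B: "(\<Sum>k<n. a k) \<le> B" for n using B[of n] by (simp add: a_def)
  have "(\<Sum>k<n. (birth_death m x k)\<^sup>2 / geo \<rho> k) \<le> (\<Sum>k<n. 3 * (b k + (1 + K)\<^sup>2 * a k + K\<^sup>2 * a (Suc k)))"
    by (intro sum_mono pointwise)
  also have "\<dots> = 3 * ((\<Sum>k<n. b k) + (1 + K)\<^sup>2 * (\<Sum>k<n. a k) + K\<^sup>2 * (\<Sum>k<n. a (Suc k)))"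
    by (simp add: sum.distrib sum_distrib_left distrib_left)
  also have "\<dots> \<le> 3 * (1 / \<rho> * B + (1 + K)\<^sup>2 * B + K\<^sup>2 * B)"
  proof (intro mult_left_mono add_mono)
    have "(\<Sum>k<n. b k) \<le> (\<Sum>k<Suc n. b k)" using a \<rho> by (simp add: b_def)
    also have "\<dots> = (\<Sum>k<n. a k / \<rho>)"
      by (simp add: sum.lessThan_Suc_shift b_def del: sum.lessThan_Suc)
    also have "\<dots> \<le> 1 / \<rho> * B"
      using B[of n] \<rho> by (simp add: divide_right_mono flip: sum_divide_distrib)
    finally show "(\<Sum>k<n. b k) \<le> 1 / \<rho> * B" .
    have "(\<Sum>k<n. a (Suc k)) \<le> (\<Sum>k<Suc n. a k)"
      using a[of 0] by (simp add: sum.lessThan_Suc_shift del: sum.lessThan_Suc)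
    also note B
    finally show "(\<Sum>k<n. a (Suc k)) \<le> B" .
  qed (use B in auto)
  finally show ?thesis by (simp add: algebra_simps)
qed

text \<open>In \<open>q\<close>, the term \<open>2 * (c - 1)\<^sup>2\<close> is the Poincare gain,
  \<open>2 * L * (1 - \<rho>)\<close> the loss from the linear part of the perturbation, and the
  \<theta> term the loss from its quadratic part. The bound \<open>\<theta> \<le> 2\<close> keeps
  the coefficient \<open>2 - \<theta>\<close> of the dissipation nonnegative, so that the Poincare
  inequality can be applied to it.\<close>

lemma energy_decay:
  fixes p :: "nat \<Rightarrow> real \<Rightarrow> real" and m :: "real \<Rightarrow> real" and c \<rho> :: real
  defines "E \<equiv> \<lambda>s k. (p k s - geo \<rho> k)\<^sup>2 / geo \<rho> k"
  assumes c: "c > 1" "\<rho> = 1 / c\<^sup>2"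
    and ode: "\<And>k s. s \<ge> 0 \<Longrightarrow>
      (p k has_real_derivative birth_death (m s) (\<lambda>j. p j s) k) (at s within {0..})"
    and p: "\<And>k s. 0 \<le> p k s" "\<And>s. (\<lambda>k. p k s) sums 1"
    and m: "\<And>s. s \<ge> 0 \<Longrightarrow> 0 \<le> m s" "\<And>s. s \<ge> 0 \<Longrightarrow> m s \<le> K"
    and init: "summable (E 0)" and "t \<ge> 0"
    and pert: "\<And>s. s \<in> {0..t} \<Longrightarrow> \<bar>m s - 1 / \<rho>\<bar> \<le> \<theta>"
      "\<And>s. s \<in> {0..t} \<Longrightarrow> \<bar>m s - 1 / \<rho>\<bar> \<le> L * \<bar>p 0 s - geo \<rho> 0\<bar>"
    and \<theta>: "\<theta> \<le> 2" and L: "L \<ge> 0"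
    and q: "q = 2 * (c - 1)\<^sup>2 - 2 * L * (1 - \<rho>) - \<theta> * (1 + (c - 1)\<^sup>2)" "q \<ge> 0"
  shows "summable (E t)" "(\<Sum>k. E t k) \<le> (\<Sum>k. E 0 k) * exp (- q * t)"
proof -
  have \<rho>: "0 < \<rho>" "\<rho> < 1" using c by (auto simp: one_less_power)
  have pos: "geo \<rho> k > 0" for k using geo_pos[OF \<rho>] .
  have p1: "p k s \<le> 1" for k s
    using sum_le_suminf[OF sums_summable[OF p(2)[of s]], of "{k}"] p(1) sums_unique[OF p(2)[of s]] by simp
  define g where "g s k = p k s / geo \<rho> k - 1" for s k
  have p_eq: "p k s = geo \<rho> k * (1 + g s k)" for k s using pos[of k] by (simp add: g_def)
  have E_eq: "E s k = geo \<rho> k * (g s k)\<^sup>2" for s k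
    using pos[of k] by (simp add: E_def p_eq power2_eq_square field_simps)
  have E0: "E s k \<ge> 0" for s k using pos[of k] by (simp add: E_eq less_imp_le)
  have mean: "(\<lambda>k. geo \<rho> k * g s k) sums 0" for s
    using sums_diff[OF p(2)[of s] geo_sums[OF \<rho>]] by (simp add: p_eq algebra_simps)
  \<comment> \<open>The uncentred squares come first because \<open>weighted_l2_growth\<close>
    concerns nonnegative sequences. In \<open>L^2\<close> of \<open>geo \<rho>\<close>, passing
    between \<open>Q\<close> and \<open>E\<close> amounts to adding or subtracting the constant
    1.\<close>
  define Q where "Q s k = (p k s)\<^sup>2 / geo \<rho> k" for s k
  have Q_eq: "Q s k = (1 / \<rho>) ^ k * (p k s)\<^sup>2 / (1 - \<rho>)" for s k
    using \<rho> by (simp add: Q_def geo_def field_simps)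
  have Q0: "Q s k \<ge> 0" for s k using pos[of k] by (simp add: Q_def less_imp_le)
  have Q_wl2: "Q s k = geo \<rho> k * (1 + g s k)\<^sup>2" for s k
    using pos[of k] by (simp add: Q_def p_eq power2_eq_square)
  have "summable (Q 0)"
  proof -
    have "wl2 \<rho> (g 0)" using init by (simp add: wl2_def E_eq[abs_def])
    from wl2_add[OF \<rho> wl2_const[OF \<rho>, of 1] this] show ?thesis
      by (simp add: wl2_def Q_wl2[abs_def])
  qed
  then have initQ: "summable (\<lambda>k. (1 / \<rho>) ^ k * (p k 0)\<^sup>2)"
    using summable_mult[of "Q 0" "1 - \<rho>"] \<rho> by (simp add: Q_eq[abs_def])
  have K: "K \<ge> 0" using m[of 0] by simp
  define B where "B = exp ((1 + K) * (1 + 1 / \<rho>) * t) * (\<Sum>k. (1 / \<rho>) ^ k * (p k 0)\<^sup>2) / (1 - \<rho>)"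
  have QB: "(\<Sum>k<n. Q s k) \<le> B" if s: "s \<in> {0..t}" for n s
  proof -
    have "(\<Sum>k<n. Q s k) \<le> (\<Sum>k\<le>n. Q s k)" using Q0 by (intro sum_mono2) auto
    also have "\<dots> = (\<Sum>k\<le>n. (1 / \<rho>) ^ k * (p k s)\<^sup>2) / (1 - \<rho>)"
      by (simp add: Q_eq sum_divide_distrib)
    also have "\<dots> \<le> exp ((1 + K) * (1 + 1 / \<rho>) * s) * (\<Sum>k. (1 / \<rho>) ^ k * (p k 0)\<^sup>2) / (1 - \<rho>)"
      using \<rho> s by (intro divide_right_mono weighted_l2_growth[where m = m] ode p(1) p1 m initQ) auto
    also have "\<dots> \<le> B"
      unfolding B_def using \<rho> s K initQ
      by (intro divide_right_mono mult_right_mono suminf_nonneg) (auto intro!: mult_left_mono)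
    finally show ?thesis .
  qed
  have wl2: "wl2 \<rho> (g s)" if s: "s \<in> {0..t}" for s
  proof -
    have "summable (Q s)"
      using Q0 QB[OF s] by (intro bounded_imp_summable[of _ B]) (simp_all only: lessThan_Suc_atMost[symmetric])
    then have "wl2 \<rho> (\<lambda>k. 1 + g s k)" by (simp add: wl2_def Q_wl2[abs_def])
    from wl2_diff[OF \<rho> this wl2_const[OF \<rho>, of 1]] show ?thesis by simp
  qed
  then have E: "summable (E s)" if "s \<in> {0..t}" for s using that by (auto simp: wl2_def E_eq[abs_def])
  have EQ: "E s k \<le> 2 * Q s k + 2 * geo \<rho> k" for s k
  proof -
    have "geo \<rho> k * (g s k)\<^sup>2 \<le> geo \<rho> k * (2 * (1 + g s k)\<^sup>2 + 2)"
      using pos[of k] zero_le_power2[of "g s k + 2"]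
      by (intro mult_left_mono) (auto simp: power2_eq_square algebra_simps)
    then show ?thesis by (simp add: E_eq Q_wl2 algebra_simps)
  qed
  have EB: "(\<Sum>k<n. E s k) \<le> 2 * B + 2" if s: "s \<in> {0..t}" for n s
  proof -
    have "(\<Sum>k<n. E s k) \<le> 2 * (\<Sum>k<n. Q s k) + 2 * (\<Sum>k<n. geo \<rho> k)"
      unfolding sum_distrib_left sum.distrib[symmetric] by (intro sum_mono EQ)
    also have "(\<Sum>k<n. geo \<rho> k) \<le> (\<Sum>k. geo \<rho> k)"
      using geo_sums[OF \<rho>] pos by (intro sum_le_suminf) (auto simp: sums_iff less_imp_le)
    also have "\<dots> = 1" using geo_sums[OF \<rho>] by (simp add: sums_iff)
    finally show ?thesis using QB[OF s, of n] by simp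
  qed
  define v where "v s k = birth_death (m s) (\<lambda>j. p j s) k" for s k
  \<comment> \<open>The factor \<open>exp (q * s)\<close> turns the claimed decay into
    monotonicity.\<close>
  define F where "F n s = exp (q * s) * (\<Sum>k<n. E s k)" for n s
  define F' where "F' n s = exp (q * s) * (q * (\<Sum>k<n. E s k) + (\<Sum>k<n. 2 * g s k * v s k))" for n s
  have E_der: "((\<lambda>s. E s k) has_real_derivative 2 * g s k * v s k) (at s within {0..t})"
    if s: "s \<in> {0..t}" for s k
  proof -
    have "(p k has_real_derivative v s k) (at s within {0..t})"
      unfolding v_def by (rule DERIV_subset[OF ode]) (use s in auto)
    from DERIV_cdivide[OF DERIV_power[OF DERIV_diff[OF this DERIV_const[of "geo \<rho> k"]], of 2], of "geo \<rho> k"]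
    show ?thesis using pos[of k] by (simp add: E_def g_def diff_divide_distrib algebra_simps)
  qed
  have F_der: "(F n has_real_derivative F' n s) (at s within {0..t})" if s: "s \<in> {0..t}" for n s
  proof -
    have e: "((\<lambda>s. exp (q * s)) has_real_derivative q * exp (q * s)) (at s within {0..t})"
      by (rule derivative_eq_intros refl | simp)+
    have "((\<lambda>s. \<Sum>k<n. E s k) has_real_derivative (\<Sum>k<n. 2 * g s k * v s k)) (at s within {0..t})"
      by (rule DERIV_sum) (rule E_der[OF s])
    from DERIV_mult[OF e this] show ?thesis
      unfolding F_def[abs_def] F'_def by (simp add: algebra_simps)
  qed
  have diss: "\<exists>A. (\<lambda>k. 2 * g s k * v s k) sums A \<and> q * (\<Sum>k. E s k) + A \<le> 0"
    if s: "s \<in> {0..t}" for s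
  proof -
    define D where "D = (\<Sum>k. geo \<rho> k * (g s (Suc k) - g s k)\<^sup>2)"
    let ?E = "\<Sum>k. E s k" and ?\<delta> = "m s - 1 / \<rho>" and ?u = "geo \<rho> 0 * g s 0"
    obtain A where A: "(\<lambda>k. 2 * g s k * v s k) sums A"
      "A \<le> - 2 * D + 2 * \<bar>?\<delta>\<bar> * \<bar>?u\<bar> + \<bar>?\<delta>\<bar> * (?E + D)"
      using energy_dissipation[OF \<rho> wl2[OF s] mean[of s] p_eq, of ?\<delta>]
      by (auto simp: v_def E_eq D_def)
    have poinc: "(c - 1)\<^sup>2 * ?E \<le> D"
      using poincare_geo[OF \<rho> c wl2[OF s] mean[of s]] by (simp add: D_def E_eq)
    have Enn: "?E \<ge> 0" using E0 E[OF s] by (intro suminf_nonneg) auto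
    have "D \<ge> 0" using poinc Enn by (meson mult_nonneg_nonneg order_trans zero_le_power2)
    have u: "?u = p 0 s - geo \<rho> 0" by (simp add: p_eq algebra_simps)
    \<comment> \<open>The perturbation sees only state 0, whose weight is \<open>1 - \<rho>\<close>.
      This is the origin of the factor \<open>S\<close> in the smallness condition on
      \<open>h' S\<close>.\<close>
    have "E s 0 \<le> ?E" using sum_le_suminf[OF E[OF s], of "{0}"] E0 by simp
    then have u2: "?u\<^sup>2 \<le> (1 - \<rho>) * ?E"
      using \<rho> mult_left_mono[of "E s 0" ?E "1 - \<rho>"] by (simp add: E_eq geo_def power2_eq_square mult_ac)
    have "\<bar>?\<delta>\<bar> * \<bar>?u\<bar> \<le> L * \<bar>?u\<bar> * \<bar>?u\<bar>"
      using pert(2)[OF s] unfolding u by (intro mult_right_mono) auto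
    also have "\<dots> = L * ?u\<^sup>2" by (simp add: power2_eq_square mult.assoc flip: abs_mult)
    also have "\<dots> \<le> L * ((1 - \<rho>) * ?E)" using u2 L by (rule mult_left_mono)
    finally have a: "\<bar>?\<delta>\<bar> * \<bar>?u\<bar> \<le> L * ((1 - \<rho>) * ?E)" .
    have b: "\<bar>?\<delta>\<bar> * (?E + D) \<le> \<theta> * (?E + D)"
      using pert(1)[OF s] Enn \<open>D \<ge> 0\<close> by (intro mult_right_mono) auto
    have "(2 - \<theta>) * ((c - 1)\<^sup>2 * ?E) \<le> (2 - \<theta>) * D" using poinc \<theta> by (intro mult_left_mono) auto
    with a b A(2) have "A \<le> 2 * (L * ((1 - \<rho>) * ?E)) + \<theta> * ?E - (2 - \<theta>) * ((c - 1)\<^sup>2 * ?E)"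
      by (simp add: algebra_simps)
    also have "\<dots> = - q * ?E" by (simp add: q algebra_simps)
    finally show ?thesis using A(1) by auto
  qed
  have F'_bound: "\<bar>F' n s\<bar> \<le> exp (q * t) * (q * (2 * B + 2) + ((2 * B + 2) + 3 * (1 / \<rho> + (1 + K)\<^sup>2 + K\<^sup>2) * B))"
    if s: "s \<in> {0..t}" for n s
  proof -
    have "\<bar>\<Sum>k<n. 2 * g s k * v s k\<bar> \<le> (\<Sum>k<n. \<bar>2 * g s k * v s k\<bar>)" by (rule sum_abs)
    also have "\<dots> \<le> (\<Sum>k<n. E s k + (v s k)\<^sup>2 / geo \<rho> k)"
    proof (rule sum_mono)
      fix k
      \<comment> \<open>Young's inequality separates \<open>g\<close> from \<open>v\<close>, and
        both resulting sums are bounded uniformly in \<open>n\<close> and \<open>s\<close>.\<close>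
      have "0 \<le> (geo \<rho> k * \<bar>g s k\<bar> - \<bar>v s k\<bar>)\<^sup>2 / geo \<rho> k" using pos[of k] by simp
      also have "\<dots> = E s k + (v s k)\<^sup>2 / geo \<rho> k - \<bar>2 * g s k * v s k\<bar>"
        using pos[of k] by (simp add: E_eq power2_diff power_mult_distrib abs_mult field_simps)
          (simp add: power2_eq_square)
      finally show "\<bar>2 * g s k * v s k\<bar> \<le> E s k + (v s k)\<^sup>2 / geo \<rho> k" by simp
    qed
    also have "\<dots> = (\<Sum>k<n. E s k) + (\<Sum>k<n. (v s k)\<^sup>2 / geo \<rho> k)" by (rule sum.distrib)
    also have "\<dots> \<le> (2 * B + 2) + 3 * (1 / \<rho> + (1 + K)\<^sup>2 + K\<^sup>2) * B"
      unfolding v_def using s QB[OF s]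
      by (intro add_mono EB birth_death_weighted_square_sum_le \<rho> m p) (auto simp: Q_def)
    finally have 1: "\<bar>\<Sum>k<n. 2 * g s k * v s k\<bar> \<le> (2 * B + 2) + 3 * (1 / \<rho> + (1 + K)\<^sup>2 + K\<^sup>2) * B" .
    have 2: "\<bar>q * (\<Sum>k<n. E s k)\<bar> \<le> q * (2 * B + 2)"
      using q(2) EB[OF s, of n] sum_nonneg[of "{..<n}" "E s"] E0 by (simp add: abs_mult mult_left_mono)
    have "exp (q * s) \<le> exp (q * t)" using s q(2) by (simp add: mult_left_mono)
    then show ?thesis unfolding F'_def abs_mult abs_exp_cancel
      by (intro mult_mono order_trans[OF abs_triangle_ineq add_mono[OF 2 1]]) auto
  qed
  define A where "A s = (\<Sum>k. 2 * g s k * v s k)" for s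
  have A: "(\<lambda>k. 2 * g s k * v s k) sums A s" "q * (\<Sum>k. E s k) + A s \<le> 0" if s: "s \<in> {0..t}" for s
    using diss[OF s] unfolding A_def sums_iff by blast+
  have "exp (q * t) * (\<Sum>k. E t k) \<le> exp (q * 0) * (\<Sum>k. E 0 k)"
  proof (rule limit_le_of_nonpos_limit_derivative[OF \<open>t \<ge> 0\<close> F_der F'_bound])
    fix s assume s: "s \<in> {0..t}"
    show "(\<lambda>n. F' n s) \<longlonglongrightarrow> exp (q * s) * (q * (\<Sum>k. E s k) + A s)"
      unfolding F'_def using A(1)[OF s] unfolding sums_def
      by (intro tendsto_mult tendsto_add tendsto_const summable_LIMSEQ E s)
    show "exp (q * s) * (q * (\<Sum>k. E s k) + A s) \<le> 0"
      using A(2)[OF s] by (simp add: mult_nonneg_nonpos)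
  next
    show "(\<lambda>n. F n 0) \<longlonglongrightarrow> exp (q * 0) * (\<Sum>k. E 0 k)"
      "(\<lambda>n. F n t) \<longlonglongrightarrow> exp (q * t) * (\<Sum>k. E t k)"
      unfolding F_def using \<open>t \<ge> 0\<close>
      by (intro tendsto_mult tendsto_const summable_LIMSEQ E; simp)+
  qed
  then have "exp (- q * t) * (exp (q * t) * (\<Sum>k. E t k)) \<le> exp (- q * t) * (\<Sum>k. E 0 k)"
    by (intro mult_left_mono) auto
  moreover have "exp (- q * t) * exp (q * t) = 1" by (simp flip: exp_add)
  ultimately show "(\<Sum>k. E t k) \<le> (\<Sum>k. E 0 k) * exp (- q * t)"
    by (simp only: mult.assoc[symmetric] mult_1) (simp only: mult.commute)
  show "summable (E t)" using E \<open>t \<ge> 0\<close> by simp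
qed

section \<open>From the test-function equation to the forward equation\<close>

lemma pmf_nat_sums: "pmf \<zeta> sums 1" for \<zeta> :: "nat pmf"
proof -
  have "(\<lambda>k. measure \<zeta> {k}) sums measure \<zeta> (\<Union>k. {k})"
    by (rule measure_pmf.finite_measure_UNION) (auto simp: disjoint_family_on_def)
  moreover have "(\<Union>k. {k}) = (UNIV :: nat set)" by auto
  ultimately show ?thesis by (simp add: measure_pmf_single)
qed

lemma pairing_eq_sum:
  assumes "\<And>k. k \<ge> N \<Longrightarrow> f k = 0"
  shows "pairing \<zeta> f = (\<Sum>k<N. f k * pmf \<zeta> k)"
proof -
  have "pairing \<zeta> f = infsum (\<lambda>k. f k * pmf \<zeta> k) {..<N}"
    unfolding pairing_def by (rule infsum_cong_neutral) (use assms in auto)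
  then show ?thesis by simp
qed

text \<open>An index shift in the downward part expresses both parts through the increments of
  \<open>f\<close>, whose coefficients are then the fluxes.\<close>

lemma pairing_generator:
  assumes f: "\<And>k. k \<ge> N \<Longrightarrow> f k = 0"
  shows "pairing \<zeta> (grad_plus f) + m * pairing \<zeta> (grad_minus f)
    = (\<Sum>k<N. (f (Suc k) - f k) * (pmf \<zeta> k - m * pmf \<zeta> (Suc k)))"
proof -
  have "pairing \<zeta> (grad_plus f) = (\<Sum>k<N. (f (Suc k) - f k) * pmf \<zeta> k)"
    by (subst pairing_eq_sum[of N]) (auto simp: grad_plus_def f)
  \<comment> \<open>One more term than for \<open>grad_plus\<close>: for \<open>N > 0\<close>,
    \<open>grad_minus f N\<close> equals \<open>f (N - 1)\<close>, which may be nonzero.\<close>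
  moreover have "pairing \<zeta> (grad_minus f) = (\<Sum>k<Suc N. grad_minus f k * pmf \<zeta> k)"
    by (rule pairing_eq_sum) (simp add: grad_minus_def f)
  then have "pairing \<zeta> (grad_minus f) = (\<Sum>k<N. (f k - f (Suc k)) * pmf \<zeta> (Suc k))"
    by (simp add: sum.lessThan_Suc_shift grad_minus_def del: sum.lessThan_Suc)
  ultimately show ?thesis
    by (simp add: sum_distrib_left sum.distrib[symmetric] algebra_simps)
qed

lemma NLQ_birth_death:
  assumes "NLQ \<nu> h \<Gamma>" "t \<ge> 0"
  shows "((\<lambda>s. pmf (\<Gamma> s) k) has_real_derivative
    birth_death (\<nu> * h (pmf (\<Gamma> t) 0)) (pmf (\<Gamma> t)) k) (at t within {0..})"
proof -
  define f :: "nat \<Rightarrow> real" where "f x = (if x = k then 1 else 0)" for x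
  have f: "f j = 0" if "j \<ge> Suc k" for j using that by (simp add: f_def)
  have "{x. f x \<noteq> 0} = {k}" by (auto simp: f_def)
  then have der: "((\<lambda>s. pairing (\<Gamma> s) f) has_real_derivative
     pairing (\<Gamma> t) (grad_plus f) + \<nu> * h (pmf (\<Gamma> t) 0) * pairing (\<Gamma> t) (grad_minus f)) (at t within {0..})"
    using assms by (simp add: NLQ_def f_def)
  have "pairing \<zeta> f = pmf \<zeta> k" for \<zeta>
    by (subst pairing_eq_sum[of "Suc k"]) (auto simp: f_def)
  moreover have "pairing \<zeta> (grad_plus f) + m * pairing \<zeta> (grad_minus f) = birth_death m (pmf \<zeta>) k" for \<zeta> m
  proof -
    have "pairing \<zeta> (grad_plus f) + m * pairing \<zeta> (grad_minus f)
        = (\<Sum>j<Suc k. (f (Suc j) - f j) * (pmf \<zeta> j - m * pmf \<zeta> (Suc j)))"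
      by (rule pairing_generator) (rule f)
    then show ?thesis by (cases k) (auto simp: f_def birth_death_def)
  qed
  ultimately show ?thesis using der by simp
qed

text \<open>Detailed balance: every flux vanishes, so the right-hand side is 0 for each test
  function.\<close>

lemma NLQ_const:
  assumes "\<And>k. pmf \<pi> k = \<nu> * h (pmf \<pi> 0) * pmf \<pi> (Suc k)"
  shows "NLQ \<nu> h (\<lambda>_. \<pi>)"
  unfolding NLQ_def
proof (intro allI impI)
  fix f :: "nat \<Rightarrow> real" and t :: real
  assume "(\<forall>x. 0 \<le> f x) \<and> finite {x. f x \<noteq> 0}"
  then obtain N where "\<forall>x\<in>{x. f x \<noteq> 0}. x < N" using finite_nat_set_iff_bounded by blast
  then have "f k = 0" if "k \<ge> N" for k using that by force
  then have gen: "pairing \<pi> (grad_plus f) + \<nu> * h (pmf \<pi> 0) * pairing \<pi> (grad_minus f)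
      = (\<Sum>k<N. (f (Suc k) - f k) * (pmf \<pi> k - \<nu> * h (pmf \<pi> 0) * pmf \<pi> (Suc k)))"
    by (rule pairing_generator)
  have bal: "pmf \<pi> k - \<nu> * h (pmf \<pi> 0) * pmf \<pi> (Suc k) = 0" for k
    unfolding right_minus_eq by (rule assms)
  have "pairing \<pi> (grad_plus f) + \<nu> * h (pmf \<pi> 0) * pairing \<pi> (grad_minus f) = 0"
    unfolding gen bal by (simp only: mult_zero_right sum.neutral_const)
  then show "((\<lambda>_. pairing \<pi> f) has_real_derivative
      pairing \<pi> (grad_plus f) + \<nu> * h (pmf \<pi> 0) * pairing \<pi> (grad_minus f)) (at t within {0..})"
    by (simp only: DERIV_const)
qed

section \<open>Local Lipschitz bound and first exit time\<close>

text \<open>The difference quotient tends to \<open>D\<close>, so its modulus is below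
  \<open>M\<close> near \<open>a\<close>. Applied to \<open>h\<close> at \<open>S\<close>, this
  turns the bound on the derivative at one point into a bound on the service rate nearby.\<close>

lemma has_real_derivative_locally_lipschitz:
  fixes f :: "real \<Rightarrow> real"
  assumes "(f has_real_derivative D) (at a within X)" "\<bar>D\<bar> < M"
  obtains e where "e > 0" "\<And>x. x \<in> X \<Longrightarrow> \<bar>x - a\<bar> < e \<Longrightarrow> \<bar>f x - f a\<bar> \<le> M * \<bar>x - a\<bar>"
proof -
  have "((\<lambda>x. \<bar>(f x - f a) / (x - a)\<bar>) \<longlongrightarrow> \<bar>D\<bar>) (at a within X)"
    using assms(1) by (intro tendsto_rabs) (simp add: has_field_derivative_iff)
  then have "\<forall>\<^sub>F x in at a within X. \<bar>(f x - f a) / (x - a)\<bar> < M"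
    using assms(2) by (rule order_tendstoD(2))
  then obtain e where e: "e > 0"
    "\<And>x. x \<in> X \<Longrightarrow> x \<noteq> a \<Longrightarrow> dist x a < e \<Longrightarrow> \<bar>(f x - f a) / (x - a)\<bar> < M"
    unfolding eventually_at by blast
  show thesis
  proof (rule that[OF e(1)])
    fix x assume "x \<in> X" "\<bar>x - a\<bar> < e"
    then show "\<bar>f x - f a\<bar> \<le> M * \<bar>x - a\<bar>"
      using e(2)[of x] by (cases "x = a") (auto simp: dist_real_def abs_divide pos_divide_less_eq)
  qed
qed

text \<open>\<tau> is the least point of the compact set where \<open>f\<close> is at least \<eta>.
  The intermediate value theorem gives a point \<sigma> \<le> \<tau> with value \<eta>, and
  minimality forces \<sigma> = \<tau>.\<close>

lemma first_exit:
  fixes f :: "real \<Rightarrow> real"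
  assumes "continuous_on {0..T} f" "T \<ge> 0" "f 0 < \<eta>" "\<eta> \<le> f T"
  obtains \<tau> where "0 \<le> \<tau>" "\<tau> \<le> T" "f \<tau> = \<eta>" "\<And>s. 0 \<le> s \<Longrightarrow> s \<le> \<tau> \<Longrightarrow> f s \<le> \<eta>"
proof -
  have "compact ({0..T} \<inter> f -` {\<eta>..})"
    unfolding compact_eq_bounded_closed
    by (intro conjI continuous_closed_preimage assms bounded_Int disjI1) auto
  moreover have "T \<in> {0..T} \<inter> f -` {\<eta>..}" using assms by simp
  ultimately obtain \<tau> where \<tau>: "\<tau> \<in> {0..T}" "\<eta> \<le> f \<tau>" "\<And>s. s \<in> {0..T} \<Longrightarrow> \<eta> \<le> f s \<Longrightarrow> \<tau> \<le> s"
    using compact_attains_inf[of "{0..T} \<inter> f -` {\<eta>..}"] by blast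
  obtain \<sigma> where \<sigma>: "0 \<le> \<sigma>" "\<sigma> \<le> \<tau>" "f \<sigma> = \<eta>"
    using IVT'[of f 0 \<eta> \<tau>] \<tau>(1,2) assms(3) continuous_on_subset[OF assms(1), of "{0..\<tau>}"] by auto
  then have "\<sigma> = \<tau>" using \<tau>(1) \<tau>(3)[of \<sigma>] by auto
  show thesis
  proof (rule that[of \<tau>])
    fix s assume "0 \<le> s" "s \<le> \<tau>"
    then show "f s \<le> \<eta>"
      using \<tau>(1) \<tau>(3)[of s] \<sigma>(3) \<open>\<sigma> = \<tau>\<close> by (cases "f s \<ge> \<eta>") auto
  qed (use \<tau> \<sigma> \<open>\<sigma> = \<tau>\<close> in auto)
qed

section \<open>Exponential stability by a continuation argument\<close>

theorem theorem3p4: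
  fixes \<nu> S :: real and h h' :: "real \<Rightarrow> real"
  assumes "\<nu> > 1"
    and "\<And>x. x \<in> {0..1} \<Longrightarrow> h x \<ge> 1"
    and "\<And>x. x \<in> {0..1} \<Longrightarrow> (h has_real_derivative h' x) (at x within {0..1})"
    and "continuous_on {0..1} h'"
    and "S \<in> {0<..<1}"
    and "S = 1 - 1 / (\<nu> * h S)"
    and "\<bar>h' S\<bar> < 1 / (\<nu> * S) * (1 / sqrt (1 - S) - 1)\<^sup>2"
  shows "NLQ \<nu> h (\<lambda>t. pi_S \<nu> h S) \<and>
    (\<exists>q>0. \<exists>\<epsilon>>0. \<forall>\<Gamma>. NLQ \<nu> h \<Gamma> \<and> l2_dist (\<Gamma> 0) (pi_S \<nu> h S) \<le> ennreal \<epsilon> \<longrightarrow>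
      (\<forall>t\<ge>0. (l2_dist (\<Gamma> t) (pi_S \<nu> h S))\<^sup>2
        \<le> (l2_dist (\<Gamma> 0) (pi_S \<nu> h S))\<^sup>2 * ennreal (exp (- q * t))))"
proof -
  define \<rho> where "\<rho> = 1 - S"
  define c where "c = 1 / sqrt \<rho>"
  \<comment> \<open>The constant of \<open>poincare_geo\<close>; the hypothesis on
    \<open>h' S\<close> amounts to \<open>\<nu> * \<bar>h' S\<bar> * S < \<gamma>\<close>.\<close>
  define \<gamma> where "\<gamma> = (c - 1)\<^sup>2"
  have S: "0 < S" "S < 1" using assms(5) by auto
  have \<rho>: "0 < \<rho>" "\<rho> < 1" using S by (auto simp: \<rho>_def)
  have c: "c > 1" "\<rho> = 1 / c\<^sup>2" using \<rho> by (auto simp: c_def power_divide)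
  have "h S \<ge> 1" using assms(2)[of S] S by simp
  then have "\<nu> * h S > 1" using assms(1) mult_left_mono[of 1 "h S" \<nu>] by linarith
  have \<rho>_eq: "1 / (\<nu> * h S) = \<rho>" using assms(6) by (simp add: \<rho>_def)
  then have \<mu>: "\<nu> * h S = 1 / \<rho>" using \<open>\<nu> * h S > 1\<close> by (auto simp: field_simps)
  have pi: "pmf (pi_S \<nu> h S) k = geo \<rho> k" for k
    using pmf_pi_S[of \<nu> h S k] \<open>\<nu> * h S > 1\<close> by (simp add: \<rho>_eq geo_def mult.commute)
  have geo0: "geo \<rho> 0 = S" by (simp add: geo_def \<rho>_def)
  have "NLQ \<nu> h (\<lambda>t. pi_S \<nu> h S)"
    by (rule NLQ_const) (use \<rho> in \<open>simp add: pi geo0 \<mu> geo_Suc\<close>)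
  moreover have "\<exists>q>0. \<exists>\<epsilon>>0. \<forall>\<Gamma>. NLQ \<nu> h \<Gamma> \<and> l2_dist (\<Gamma> 0) (pi_S \<nu> h S) \<le> ennreal \<epsilon> \<longrightarrow>
      (\<forall>t\<ge>0. (l2_dist (\<Gamma> t) (pi_S \<nu> h S))\<^sup>2
        \<le> (l2_dist (\<Gamma> 0) (pi_S \<nu> h S))\<^sup>2 * ennreal (exp (- q * t)))"
  proof -
    have "\<gamma> > 0" using c(1) by (simp add: \<gamma>_def)
    have "\<nu> * \<bar>h' S\<bar> < \<gamma> / S"
      using assms(1,7) S by (simp add: \<gamma>_def c_def \<rho>_def field_simps)
    \<comment> \<open>\<open>L\<close> needs room on both sides: above
      \<open>\<nu> * \<bar>h' S\<bar>\<close> for the local Lipschitz bound, below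
      \<open>\<gamma> / S\<close> for a positive decay rate.\<close>
    then obtain L where L: "\<nu> * \<bar>h' S\<bar> < L" "L < \<gamma> / S" using dense by blast
    have L0: "L > 0" using L(1) mult_nonneg_nonneg[of \<nu> "\<bar>h' S\<bar>"] assms(1) by linarith
    \<comment> \<open>\<theta> spends half of the margin \<open>2 * (\<gamma> - L * S)\<close>,
      which leaves \<open>q = \<gamma> - L * S\<close>.\<close>
    define \<theta> where "\<theta> = (\<gamma> - L * S) / (1 + \<gamma>)"
    define q where "q = 2 * (c - 1)\<^sup>2 - 2 * L * (1 - \<rho>) - \<theta> * (1 + (c - 1)\<^sup>2)"
    have gap: "\<gamma> - L * S > 0" using L(2) S by (simp add: field_simps)
    have \<theta>: "0 < \<theta>" "\<theta> \<le> 2" using gap \<open>\<gamma> > 0\<close> L0 S by (auto simp: \<theta>_def field_simps)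
    have "\<theta> * (1 + \<gamma>) = \<gamma> - L * S" using \<open>\<gamma> > 0\<close> by (simp add: \<theta>_def)
    then have "q > 0" using gap by (simp add: q_def \<rho>_def flip: \<gamma>_def)
    have "\<bar>h' S\<bar> < L / \<nu>" using L(1) assms(1) by (simp add: field_simps)
    with assms(3)[of S] S obtain e where e: "e > 0"
      "\<And>x. x \<in> {0..1} \<Longrightarrow> \<bar>x - S\<bar> < e \<Longrightarrow> \<bar>h x - h S\<bar> \<le> L / \<nu> * \<bar>x - S\<bar>"
      by (auto elim: has_real_derivative_locally_lipschitz)
    \<comment> \<open>\<open>e / 2\<close> stays strictly inside the neighbourhood of the Lipschitz
      bound, and \<open>\<theta> / L\<close> keeps the deviation of the service rate below
      \<theta>.\<close>
    define \<eta> where "\<eta> = min (e / 2) (\<theta> / L)"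
    have \<eta>: "0 < \<eta>" "\<eta> < e" "L * \<eta> \<le> \<theta>"
      using e(1) \<theta> L0 by (auto simp: \<eta>_def min_def field_simps)
    have lip: "\<bar>\<nu> * h x - 1 / \<rho>\<bar> \<le> L * \<bar>x - S\<bar>" if "x \<in> {0..1}" "\<bar>x - S\<bar> \<le> \<eta>" for x
    proof -
      have "\<nu> * \<bar>h x - h S\<bar> \<le> \<nu> * (L / \<nu> * \<bar>x - S\<bar>)"
        using that \<eta> assms(1) by (intro mult_left_mono e(2)) auto
      moreover have "\<nu> * \<bar>h x - h S\<bar> = \<bar>\<nu> * h x - 1 / \<rho>\<bar>"
        using assms(1) by (simp add: abs_mult flip: \<mu> right_diff_distrib)
      ultimately show ?thesis using assms(1) by simp
    qed
    \<comment> \<open>Compactness bounds \<open>h\<close>, and \<open>\<nu> * H\<close> is the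
      uniform bound on the service rate required by \<open>energy_decay\<close>.\<close>
    have "continuous_on {0..1} h"
      unfolding continuous_on_eq_continuous_within using assms(3) by (blast intro: DERIV_continuous)
    then have "bounded (h ` {0..1})" by (intro compact_imp_bounded compact_continuous_image) auto
    then obtain H where H: "\<And>x. x \<in> {0..1} \<Longrightarrow> \<bar>h x\<bar> \<le> H" unfolding bounded_iff by fastforce
    \<comment> \<open>The radius \<epsilon> is \<open>\<eta> / 2\<close>, not \<eta>: the factor 2
      is the slack that rules out an exit.\<close>
    have decay: "(l2_dist (\<Gamma> t) (pi_S \<nu> h S))\<^sup>2
        \<le> (l2_dist (\<Gamma> 0) (pi_S \<nu> h S))\<^sup>2 * ennreal (exp (- q * t))"
      if \<Gamma>: "NLQ \<nu> h \<Gamma>" and init: "l2_dist (\<Gamma> 0) (pi_S \<nu> h S) \<le> ennreal (\<eta> / 2)" and "t \<ge> 0" for \<Gamma> t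
    proof -
      define p where "p k s = pmf (\<Gamma> s) k" for k s
      define E where "E s k = (p k s - geo \<rho> k)\<^sup>2 / geo \<rho> k" for s k
      have E0: "E s k \<ge> 0" for s k using geo_pos[OF \<rho>, of k] by (simp add: E_def less_imp_le)
      have l2: "(l2_dist (\<Gamma> s) (pi_S \<nu> h S))\<^sup>2 = (\<Sum>k. ennreal (E s k))" for s
        by (simp add: l2_dist_power2 pi E_def p_def)
      have p01: "p k s \<in> {0..1}" for k s by (simp add: p_def pmf_le_1)
      have ode: "(p k has_real_derivative birth_death (\<nu> * h (p 0 s)) (\<lambda>j. p j s) k) (at s within {0..})"
        if "s \<ge> 0" for k s
        using NLQ_birth_death[OF \<Gamma> that, of k] by (simp add: p_def[abs_def])
      have le: "(\<Sum>k. ennreal (E 0 k)) \<le> ennreal ((\<eta> / 2)\<^sup>2)"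
        using power_mono[OF init, of 2] \<eta> by (simp add: l2 ennreal_power)
      then have "(\<Sum>k. ennreal (E 0 k)) \<noteq> top" by (rule neq_top_trans[OF ennreal_neq_top])
      then have sE0: "summable (E 0)" using E0 by (intro summable_suminf_not_top) auto
      have eq0: "(\<Sum>k. ennreal (E 0 k)) = ennreal (\<Sum>k. E 0 k)"
        by (rule suminf_ennreal2[OF E0 sE0])
      then have E0_le: "(\<Sum>k. E 0 k) \<le> (\<eta> / 2)\<^sup>2" using le by simp
      \<comment> \<open>The deviation at state 0 is controlled by the energy alone, so decay of the
        energy keeps the service rate near its equilibrium value.\<close>
      have u_le: "(p 0 s - S)\<^sup>2 \<le> (\<Sum>k. E s k)" if "summable (E s)" for s
      proof -
        have "(p 0 s - S)\<^sup>2 = S * E s 0" using S by (simp add: E_def geo0)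
        also have "\<dots> \<le> 1 * E s 0" using S E0 by (intro mult_right_mono) auto
        also have "\<dots> \<le> (\<Sum>k. E s k)" using sum_le_suminf[OF that, of "{0}"] E0 by simp
        finally show ?thesis .
      qed
      have energy: "summable (E t)" "(\<Sum>k. E t k) \<le> (\<Sum>k. E 0 k) * exp (- q * t)"
        if t: "t \<ge> 0" and near: "\<And>s. 0 \<le> s \<Longrightarrow> s \<le> t \<Longrightarrow> \<bar>p 0 s - S\<bar> \<le> \<eta>" for t
      proof -
        have pert: "\<bar>\<nu> * h (p 0 s) - 1 / \<rho>\<bar> \<le> L * \<bar>p 0 s - geo \<rho> 0\<bar>" if "s \<in> {0..t}" for s
          using lip[OF p01 near[of s]] that by (simp add: geo0)
        have pert\<theta>: "\<bar>\<nu> * h (p 0 s) - 1 / \<rho>\<bar> \<le> \<theta>" if "s \<in> {0..t}" for s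
        proof -
          have "L * \<bar>p 0 s - S\<bar> \<le> L * \<eta>" using near[of s] that L0 by (intro mult_left_mono) auto
          then show ?thesis using pert[OF that] \<eta>(3) by (simp add: geo0)
        qed
        have m: "0 \<le> \<nu> * h (p 0 s)" "\<nu> * h (p 0 s) \<le> \<nu> * H" for s
          using assms(1) assms(2)[OF p01[of 0 s]] H[OF p01[of 0 s]] by (auto intro!: mult_left_mono)
        note decay = energy_decay[where p = p and m = "\<lambda>s. \<nu> * h (p 0 s)" and K = "\<nu> * H" and t = t
            and \<theta> = \<theta> and L = L and q = q, OF c ode _ _ m _ t pert\<theta> pert \<theta>(2) less_imp_le[OF L0] q_def
            less_imp_le[OF \<open>q > 0\<close>], folded E_def]
        have "0 \<le> p k s" "(\<lambda>k. p k s) sums 1" for k s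
          using p01 pmf_nat_sums by (auto simp: p_def[abs_def])
        then show "summable (E t)" "(\<Sum>k. E t k) \<le> (\<Sum>k. E 0 k) * exp (- q * t)"
          using decay sE0 by blast+
      qed
      \<comment> \<open>Up to and including the first exit time the closed condition
        \<open>\<le> \<eta>\<close> holds, so \<open>energy\<close> applies there. It yields a
        deviation of at most \<open>\<eta> / 2\<close>, against the value \<eta> at the
        exit.\<close>
      have near: "\<bar>p 0 s - S\<bar> < \<eta>" if "s \<ge> 0" for s
      proof (rule ccontr)
        assume "\<not> \<bar>p 0 s - S\<bar> < \<eta>"
        then have exit: "\<eta> \<le> \<bar>p 0 s - S\<bar>" by simp
        have start: "\<bar>p 0 0 - S\<bar> < \<eta>"
          using order_trans[OF u_le[OF sE0] E0_le] \<eta> abs_le_square_iff[of "p 0 0 - S" "\<eta> / 2"] by simp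
        have "continuous_on {0..} (p 0)"
          unfolding continuous_on_eq_continuous_within using DERIV_continuous[OF ode] by auto
        then have "continuous_on {0..s} (p 0)" by (rule continuous_on_subset) auto
        then have "continuous_on {0..s} (\<lambda>r. \<bar>p 0 r - S\<bar>)"
          by (intro continuous_on_rabs continuous_on_diff continuous_on_const)
        then obtain \<tau> where \<tau>: "0 \<le> \<tau>" "\<tau> \<le> s" "\<bar>p 0 \<tau> - S\<bar> = \<eta>"
          "\<And>r. 0 \<le> r \<Longrightarrow> r \<le> \<tau> \<Longrightarrow> \<bar>p 0 r - S\<bar> \<le> \<eta>"
          by (rule first_exit[OF _ \<open>s \<ge> 0\<close> start exit]) (blast intro: that)
        have "(\<Sum>k. E \<tau> k) \<le> (\<Sum>k. E 0 k) * exp (- q * \<tau>)" by (rule energy(2)[OF \<tau>(1,4)])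
        also have "\<dots> \<le> (\<Sum>k. E 0 k) * 1"
          using \<open>q > 0\<close> \<tau>(1) E0 sE0 by (intro mult_left_mono suminf_nonneg) auto
        also have "\<dots> \<le> (\<eta> / 2)\<^sup>2" using E0_le by simp
        finally have "(p 0 \<tau> - S)\<^sup>2 \<le> (\<eta> / 2)\<^sup>2" using u_le[OF energy(1)[OF \<tau>(1,4)]] by simp
        then have "\<bar>p 0 \<tau> - S\<bar> \<le> \<eta> / 2" using \<eta> abs_le_square_iff[of "p 0 \<tau> - S" "\<eta> / 2"] by simp
        then show False using \<tau>(3) \<eta>(1) by simp
      qed
      have "\<bar>p 0 s - S\<bar> \<le> \<eta>" if "0 \<le> s" "s \<le> t" for s using near[OF that(1)] by (rule less_imp_le)
      then have "summable (E t)" "(\<Sum>k. E t k) \<le> (\<Sum>k. E 0 k) * exp (- q * t)"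
        using energy[OF \<open>t \<ge> 0\<close>] by blast+
      then have "(\<Sum>k. ennreal (E t k)) \<le> ennreal ((\<Sum>k. E 0 k) * exp (- q * t))"
        using suminf_ennreal2[OF E0 \<open>summable (E t)\<close>] by (simp add: ennreal_leI)
      also have "\<dots> = (\<Sum>k. ennreal (E 0 k)) * ennreal (exp (- q * t))"
        using E0 sE0 by (simp add: eq0 ennreal_mult suminf_nonneg)
      finally show ?thesis by (simp add: l2)
    qed
    show ?thesis
      using \<open>q > 0\<close> \<eta>(1) decay by (intro exI[of _ q] exI[of _ "\<eta> / 2"] conjI) auto
  qed
  ultimately show ?thesis ..
qed

end
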